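(* Let $F$ be a field and let $D$ be a central division algebra over $F$, i.e. a division ring with center $F$ such that $\dim_F D<\infty$. Then there exist $x,y\in D^*$ such that $F(xyx^{-1}y^{-1})$ is a maximal subfield of $D$.
   Context: A division algebra over a field $F$ is a division ring $D$ whose center $Z(D)=\{a\in D\mid ab=ba \text{ for all } b\in D\}$ equals $F$ and which is finite dimensional as an $F$-vector space. $D^*=D\setminus\{0\}$. For $c\in D$, $F(c)$ denotes the subfield of $D$ generated by $F$ and $c$. A maximal subfield of $D$ is a subfield of $D$ that is maximal with respect to inclusion among the subfields (commutative division subrings) of $D$. *)

theory Defs
  imports Complex_Main
begin

definition ring_center :: "'d::ring set" where
  "ring_center = {a. \<forall>b. a * b = b * a}"

text \<open>
  The field \<open>F\<close> is the type \<open>'f\<close>, the division ring \<open>D\<close> is the type \<open>'d\<close>, and \<open>F\<close> sits inside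
  \<open>D\<close> as the set of all \<open>scale a 1\<close>.
\<close>

definition scalars :: "('f::field \<Rightarrow> 'd::division_ring \<Rightarrow> 'd) \<Rightarrow> 'd set" where
  "scalars scale = range (\<lambda>a. scale a 1)"

locale central_division_algebra = vector_space scale
  for scale :: "'f::field \<Rightarrow> 'd::division_ring \<Rightarrow> 'd" +
  assumes scale_mult_left: "scale a x * y = scale a (x * y)"
    and scale_mult_right: "x * scale a y = scale a (x * y)"
    and center_eq_scalars: "ring_center = scalars scale"
    and finite_dim: "\<exists>B. finite B \<and> span B = UNIV"

text \<open>A subfield is a commutative division subring; it need not contain \<open>F\<close>.\<close>

definition is_subfield :: "'d::division_ring set \<Rightarrow> bool" where
  "is_subfield K \<longleftrightarrow>
     1 \<in> K \<and>
     (\<forall>x\<in>K. \<forall>y\<in>K. x - y \<in> K \<and> x * y \<in> K \<and> x * y = y * x) \<and>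
     (\<forall>x\<in>K. x \<noteq> 0 \<longrightarrow> inverse x \<in> K)"

definition is_maximal_subfield :: "'d::division_ring set \<Rightarrow> bool" where
  "is_maximal_subfield M \<longleftrightarrow>
     is_subfield M \<and> (\<forall>K. is_subfield K \<and> M \<subseteq> K \<longrightarrow> K = M)"

text \<open>
  \<open>F(c)\<close> is the intersection of all subfields containing \<open>F\<close> and \<open>c\<close>.  For a set of
  non-commuting elements this family would be empty and the hull would be \<open>UNIV\<close>; as \<open>F\<close> is
  central this does not happen here, see \<open>is_subfield_adjoin\<close> below.
\<close>

definition adjoin :: "('f::field \<Rightarrow> 'd::division_ring \<Rightarrow> 'd) \<Rightarrow> 'd \<Rightarrow> 'd set" where
  "adjoin scale c = is_subfield hull (insert c (scalars scale))"

lemma inverse_commute: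
  fixes x z :: "'d::division_ring"
  assumes "x * z = z * x"
  shows "inverse x * z = z * inverse x"
proof (cases "x = 0")
  case False
  have "inverse x * z = inverse x * (z * x) * inverse x"
    using False by (simp add: mult.assoc)
  also have "\<dots> = inverse x * (x * z) * inverse x"
    using assms by (rule arg_cong[where f = "\<lambda>t. inverse x * t * inverse x", OF sym])
  also have "\<dots> = z * inverse x"
    using False by (simp flip: mult.assoc)
  finally show ?thesis .
qed simp

lemma is_subfield_hull:
  fixes S :: "'d::division_ring set"
  assumes "\<forall>x\<in>S. \<forall>y\<in>S. x * y = y * x"
  shows "is_subfield (is_subfield hull S)"
proof -
  define C where "C = {z. \<forall>s\<in>S. z * s = s * z}"
  define K where "K = {x. \<forall>z\<in>C. x * z = z * x}"
  have SK: "S \<subseteq> K" unfolding K_def C_def by fastforce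
  have SC: "S \<subseteq> C" using assms unfolding C_def by blast
  have KC: "K \<subseteq> C" using SC unfolding K_def C_def by blast
  have comm: "x * y = y * x" if "x \<in> K" "y \<in> K" for x y
    using that KC unfolding K_def by blast
  have mult: "x * y \<in> K" if "x \<in> K" "y \<in> K" for x y
    unfolding K_def
  proof (intro CollectI ballI)
    fix z assume "z \<in> C"
    then have "x * z = z * x" "y * z = z * y" using that unfolding K_def by blast+
    then show "x * y * z = z * (x * y)" by (metis mult.assoc)
  qed
  have diff: "x - y \<in> K" if "x \<in> K" "y \<in> K" for x y
    using that unfolding K_def by (simp add: left_diff_distrib right_diff_distrib)
  have inv: "inverse x \<in> K" if "x \<in> K" for x
    using that unfolding K_def by (blast intro: inverse_commute)
  have one: "1 \<in> K" by (simp add: K_def)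
  have K: "is_subfield K"
    unfolding is_subfield_def by (intro conjI ballI impI) (rule one diff mult comm inv; assumption)+
  define H where "H = is_subfield hull S"
  have mem: "x \<in> H \<longleftrightarrow> (\<forall>T. is_subfield T \<longrightarrow> S \<subseteq> T \<longrightarrow> x \<in> T)" for x
    unfolding H_def hull_def by blast
  have sub: "H \<subseteq> K" using SK K mem by blast
  have "is_subfield H"
    unfolding is_subfield_def
  proof (intro conjI ballI impI)
    show "1 \<in> H"
      unfolding mem by (simp add: is_subfield_def)
  next
    fix x y assume "x \<in> H" "y \<in> H"
    then show "x - y \<in> H" "x * y \<in> H"
      unfolding mem by (meson is_subfield_def)+
    show "x * y = y * x"
      using \<open>x \<in> H\<close> \<open>y \<in> H\<close> sub by (intro comm) auto
  next
    fix x assume "x \<in> H" "x \<noteq> 0"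
    then show "inverse x \<in> H"
      unfolding mem by (meson is_subfield_def)
  qed
  then show ?thesis by (simp only: H_def)
qed

lemma (in central_division_algebra) is_subfield_adjoin:
  "is_subfield (adjoin scale c)"
  unfolding adjoin_def
proof (rule is_subfield_hull, intro ballI)
  fix x y assume "x \<in> insert c (scalars scale)" "y \<in> insert c (scalars scale)"
  then have "x = c \<or> x \<in> ring_center" "y = c \<or> y \<in> ring_center"
    by (simp_all add: center_eq_scalars)
  then show "x * y = y * x" unfolding ring_center_def by (metis (mono_tags, lifting) mem_Collect_eq)
qed

end

theory Submission
  imports Defs "HOL-Computational_Algebra.Polynomial_Factorial"
    "HOL-Computational_Algebra.Fundamental_Theorem_Algebra"
begin

text \<open>
  If \<open>F\<close> is finite then \<open>D\<close> is commutative (Wedderburn) and \<open>x = y = 1\<close> will do.  Let \<open>F\<close> be infinite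
  and \<open>D\<close> noncommutative.  Linear independence of vectors depending polynomially on a parameter
  \<open>s \<in> F\<close> is a generic condition.

  For \<open>d \<in> D\<close> with minimal polynomial \<open>p = \<Sum> c\<^sub>i X\<^sup>i\<close> of degree \<open>m\<close>, let \<open>\<Delta>\<close> be the derivative of \<open>p\<close> at \<open>d\<close>,
  \<open>\<Delta> e = \<Sum>\<^sub>i c\<^sub>i \<Sum>\<^sub>j\<^sub><\<^sub>i d\<^sup>j e d\<^sup>i\<^sup>-\<^sup>1\<^sup>-\<^sup>j\<close>.  Its image is a nonzero left ideal of the centralizer \<open>C(d)\<close>, hence all of
  \<open>C(d)\<close>; and if no \<open>d + s e\<close> has degree greater than \<open>m\<close>, then \<open>\<Delta> e \<in> F[d]\<close>.  Choose \<open>d = a b - b a\<close> of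
  maximal degree among all additive commutators; generically \<open>a\<close> and \<open>d\<close> do not commute.  Varying \<open>b\<close>
  gives \<open>\<Delta> (a y - y a) \<in> F[d]\<close> for all \<open>y\<close>, so also
  \<open>\<Delta> ((a d - d a) y) = \<Delta> (a (d y) - (d y) a) - d \<Delta> (a y - y a) \<in> F[d]\<close>, that is \<open>C(d) \<subseteq> F[d]\<close>.

  Finally the multiplicative commutator of \<open>1 + s a\<close> and \<open>1 + s b\<close> is \<open>1 + \<mu> g(s)\<close> with \<open>\<mu> \<in> F\<close> and \<open>g\<close>
  polynomial in \<open>s\<close>, \<open>g(0) = d\<close>; both the degree of \<open>d\<close> and the rank of \<open>y \<mapsto> d y - y d\<close> persist
  generically, so the centralizer of this commutator is the field it generates.
\<close>

section \<open>A substitute for cyclotomic values\<close>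

lemma prod_mset_gt_bound:
  fixes b :: real
  assumes "A \<noteq> {#}" "b \<ge> 1" "\<And>x. x \<in># A \<Longrightarrow> f x > b"
  shows "prod_mset (image_mset f A) > b"
  using assms(1,3)
proof (induction A)
  case (add x A)
  show ?case
  proof (cases "A = {#}")
    case False
    then have "prod_mset (image_mset f A) > 1"
      using add assms(2) by force
    moreover have "f x > b" using add.prems by simp
    ultimately show ?thesis
      using assms(2) mult_less_le_imp_less[of b "f x" 1 "prod_mset (image_mset f A)"] by simp
  qed (use add in simp)
qed simp

lemma cis_power_neq_1:
  fixes d N :: nat
  assumes "0 < d" "d < N"
  shows "cis (2 * pi / N) ^ d \<noteq> 1"
proof
  assume "cis (2 * pi / N) ^ d = 1"
  then have "cis (2 * pi * d / N) = 1" by (simp add: DeMoivre mult_ac)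
  then have "cos (2 * pi * d / N) = 1" by (simp add: complex_eq_iff)
  then obtain k :: int where k: "2 * pi * d / N = k * 2 * pi"
    by (auto simp: cos_one_2pi_int)
  then have "real d = k * N" using assms by (simp add: field_simps)
  then have "int d = k * int N" by (metis of_int_eq_iff of_int_mult of_int_of_nat_eq)
  then have "int N dvd int d" by simp
  then show False using assms by (auto dest: dvd_imp_le)
qed

lemma map_poly_of_int_mult:
  "map_poly of_int (p * q) = (map_poly of_int p * map_poly of_int q :: 'a::{comm_ring_1,ring_char_0} poly)"
  by (rule poly_eqI) (simp add: coeff_map_poly coeff_mult)

text \<open>Split \<open>p\<close> into primes of \<open>\<int>[X]\<close>: a zero of a product is a
  zero of a factor, and unit constants have no zeros. The factor found stands in for a minimal
  polynomial of \<open>x\<close>.\<close>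

lemma int_poly_prime_factor_root:
  fixes p :: "int poly" and x :: "'a::field_char_0"
  assumes "p \<noteq> 0" "poly (map_poly of_int p) x = 0"
  shows "\<exists>P. prime P \<and> P dvd p \<and> poly (map_poly of_int P) x = 0"
  using assms
proof (induction p rule: prime_divisors_induct)
  case (unit p)
  then obtain c where "p = [:c:]" "c dvd 1" by (auto simp: is_unit_poly_iff)
  with unit show ?case by (auto simp: map_poly_pCons)
next
  case (factor q p)
  have "poly (map_poly of_int q) x = 0 \<or> poly (map_poly of_int p) x = 0"
    using factor.prems(2) by (simp add: map_poly_of_int_mult)
  then show ?case
  proof
    assume "poly (map_poly of_int p) x = 0"
    then have "\<exists>P. prime P \<and> P dvd p \<and> poly (map_poly of_int P) x = 0"
      using factor.IH factor.prems(1) by simp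
    then show ?thesis by (blast intro: dvd_mult)
  qed (use factor.hyps in \<open>blast intro: dvd_triv_left\<close>)
qed simp

lemma map_poly_of_int_monom_diff:
  "map_poly of_int (monom 1 k - 1 :: int poly) = (monom 1 k - 1 :: 'a::{comm_ring_1,ring_char_0} poly)"
  by (rule poly_eqI) (auto simp: coeff_map_poly)

text \<open>\<open>norm (q - x)\<close> is at least \<open>q - Re x\<close>, and on the unit circle
  \<open>Re x = 1\<close> happens only at \<open>x = 1\<close>.\<close>

lemma norm_diff_unit_gt:
  fixes x :: complex
  assumes "norm x = 1" "x \<noteq> 1"
  shows "norm (of_real q - x) > q - 1"
proof -
  have "Re x \<noteq> 1"
    using assms by (auto simp: cmod_def complex_eq_iff)
  moreover have "Re x \<le> 1" using complex_Re_le_cmod[of x] assms by simp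
  moreover have "q - Re x \<le> norm (of_real q - x)"
    using complex_Re_le_cmod[of "of_real q - x"] by simp
  ultimately show ?thesis by linarith
qed

text \<open>The value at \<open>q\<close> of the irreducible integer polynomial of a primitive \<open>N\<close>-th root of
  unity plays the role of the cyclotomic value; only irreducibility is needed.\<close>
lemma ex_cyclotomic_value:
  fixes q N :: nat
  assumes q: "q \<ge> 2" and N: "N \<ge> 2"
  obtains Q :: int where "\<bar>Q\<bar> > int q - 1" "Q dvd int q ^ N - 1"
    "\<And>k. 0 < k \<Longrightarrow> k < N \<Longrightarrow> k dvd N \<Longrightarrow> \<exists>r. int q ^ N - 1 = (int q ^ k - 1) * (Q * r)"
proof -
  define x where "x = cis (2 * pi / N)"
  define h :: "int poly" where "h = monom 1 N - 1"
  have xN: "x ^ N = 1" using N by (simp add: x_def DeMoivre)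
  have h0: "h \<noteq> 0"
    using N unfolding h_def by (metis eq_iff_diff_eq_0 degree_1 degree_monom_eq not_numeral_le_zero one_neq_zero)
  have "poly (map_poly of_int h) x = 0"
    by (simp add: h_def map_poly_of_int_monom_diff poly_monom xN)
  then obtain P :: "int poly" where P: "prime P" "P dvd h" "poly (map_poly of_int P) x = 0"
    using int_poly_prime_factor_root[OF h0] by blast
  \<comment> \<open>The prime \<open>P\<close> divides
    \<open>X^N - 1 = (X^k - 1) * (1 + X^k + ...)\<close> but not the first factor, since
    \<open>x\<close> has order \<open>N > k\<close>; hence it divides the geometric sum. The case
    \<open>k = 1\<close> of the second conjunct serves to show
    \<open>P(1) \<noteq> 0\<close>.\<close>
  have P_dvd: "\<exists>S. h = (monom 1 k - 1) * (P * S) \<and> S * P = (\<Sum>i<N div k. monom 1 k ^ i)"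
    if k: "0 < k" "k < N" "k dvd N" for k
  proof -
    have "monom 1 k ^ (N div k) = (monom 1 N :: int poly)"
      using k by (simp add: monom_power)
    then have h: "h = (monom 1 k - 1) * (\<Sum>i<N div k. monom 1 k ^ i)"
      using power_diff_1_eq[of "monom 1 k :: int poly" "N div k"] by (simp add: h_def)
    have "\<not> P dvd monom 1 k - 1"
    proof
      assume "P dvd monom 1 k - 1"
      then obtain R where "monom 1 k - 1 = P * R" by (elim dvdE)
      then have "poly (monom 1 k - 1) x = 0"
        using P(3) by (metis map_poly_of_int_monom_diff map_poly_of_int_mult mult_zero_left poly_mult)
      then show False using cis_power_neq_1[OF k(1,2)] by (simp add: poly_monom x_def)
    qed
    then have "P dvd (\<Sum>i<N div k. monom 1 k ^ i)"
      using P(1,2) h by (metis prime_dvd_mult_iff)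
    then show ?thesis using h by (metis dvdE mult.commute)
  qed
  define Q where "Q = poly P (int q)"
  have hq: "poly h (int q) = int q ^ N - 1" by (simp add: h_def poly_monom)
  \<comment> \<open>\<open>P\<close> divides \<open>1 + X + ... + X^(N-1)\<close>, whose value at 1
    is \<open>N\<close>.\<close>
  have P1: "poly P 1 \<noteq> 0"
  proof
    assume "poly P 1 = 0"
    moreover obtain S where "S * P = (\<Sum>i<N. monom 1 1 ^ i)"
      using P_dvd[of 1] N by auto
    ultimately have "poly (\<Sum>i<N. monom 1 1 ^ i) (1::int) = 0" by (metis mult_zero_right poly_mult)
    then show False using N by (simp add: poly_sum poly_monom)
  qed
  define Pc :: "complex poly" where "Pc = map_poly of_int P"
  have P0: "P \<noteq> 0" using P(1) by auto
  then have Pc0: "Pc \<noteq> 0" by (simp add: Pc_def map_poly_eq_0_iff)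
  have root: "norm z = 1 \<and> z \<noteq> 1" if "poly Pc z = 0" for z
  proof
    obtain R where "h = P * R" using P(2) by (elim dvdE)
    then have "poly (map_poly of_int h) z = 0" using that by (simp add: map_poly_of_int_mult Pc_def)
    then have "z ^ N = 1" by (simp add: h_def map_poly_of_int_monom_diff poly_monom)
    then show "norm z = 1" using N power_eq_1_iff[of z N] by auto
    have "poly Pc 1 = of_int (poly P 1)"
      by (simp add: Pc_def poly_altdef coeff_map_poly degree_map_poly)
    then show "z \<noteq> 1" using that P1 by auto
  qed
  \<comment> \<open>Factoring over the complex numbers, \<open>Q\<close> is the leading coefficient,
    of modulus at least 1, times a product of \<open>q - z\<close> over roots of unity
    \<open>z \<noteq> 1\<close>, each of modulus above \<open>q - 1\<close>.\<close>
  have "of_int Q = poly Pc (of_int q)"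
    by (simp add: Pc_def Q_def poly_altdef coeff_map_poly degree_map_poly)
  also have "\<dots> = lead_coeff Pc * (\<Prod>z\<in>#proots Pc. of_int q - z)"
    by (subst complex_poly_decompose_multiset[of Pc, symmetric])
       (simp add: poly_prod_mset image_mset.compositionality o_def)
  finally have "norm (of_int Q :: complex) = norm (lead_coeff Pc) * norm (\<Prod>z\<in>#proots Pc. of_int q - z)"
    by (simp add: norm_mult)
  also have "norm (lead_coeff Pc) = of_int \<bar>lead_coeff P\<bar>"
    by (simp add: Pc_def degree_map_poly coeff_map_poly)
  also have "norm (\<Prod>z\<in>#A. of_int q - z) = (\<Prod>z\<in>#A. norm (of_int q - z))" for A :: "complex multiset"
    by (induction A) (auto simp: norm_mult)
  finally have Q_eq: "\<bar>real_of_int Q\<bar> = of_int \<bar>lead_coeff P\<bar> * (\<Prod>z\<in>#proots Pc. norm (of_int q - z))"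
    by simp
  \<comment> \<open>At least one factor is present; an empty product would only give 1.\<close>
  have "x \<in># proots Pc" using Pc0 P(3) by (simp add: Pc_def)
  then have "proots Pc \<noteq> {#}" by auto
  then have prod_gt: "(\<Prod>z\<in>#proots Pc. norm (of_int q - z)) > real q - 1"
    using q root Pc0 norm_diff_unit_gt[of _ "real q"]
    by (intro prod_mset_gt_bound) auto
  have "lead_coeff P \<noteq> 0" using P0 by simp
  then have "\<bar>lead_coeff P\<bar> \<ge> 1" by linarith
  then have "real_of_int \<bar>lead_coeff P\<bar> \<ge> 1" by linarith
  then have "1 * (\<Prod>z\<in>#proots Pc. norm (of_int q - z)) \<le> \<bar>real_of_int Q\<bar>"
    unfolding Q_eq using prod_gt q by (intro mult_right_mono) auto
  then have "\<bar>real_of_int Q\<bar> > real q - 1"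
    using prod_gt by linarith
  then have Q_gt: "\<bar>Q\<bar> > int q - 1" by linarith
  have Q_dvd: "Q dvd int q ^ N - 1"
    using P(2) hq by (metis Q_def dvdE dvd_triv_left poly_mult)
  have Q_quot: "\<exists>r. int q ^ N - 1 = (int q ^ k - 1) * (Q * r)" if k: "0 < k" "k < N" "k dvd N" for k
  proof -
    obtain S where S: "h = (monom 1 k - 1) * (P * S)" using P_dvd[OF k] by blast
    have "int q ^ N - 1 = (int q ^ k - 1) * (Q * poly S (int q))"
      using arg_cong[OF S, of "\<lambda>p. poly p (int q)"] by (simp add: hq poly_monom Q_def)
    then show ?thesis by blast
  qed
  show ?thesis by (rule that[OF Q_gt Q_dvd Q_quot])
qed

text \<open>Euclidean descent by \<open>q^N - 1 = (q^k - 1) * q^(N-k) + (q^(N-k) - 1)\<close>. Once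
  \<open>N < k\<close>, divisibility forces \<open>q^N = 1\<close>, so \<open>N = 0\<close>.\<close>

lemma dvd_of_power_minus_1_dvd:
  fixes q k N :: nat
  assumes "q \<ge> 2" "k > 0" "q ^ k - 1 dvd q ^ N - 1"
  shows "k dvd N"
  using assms(3)
proof (induction N rule: less_induct)
  case (less N)
  show ?case
  proof (cases "N < k")
    case True
    then have "q ^ N - 1 < q ^ k - 1"
      using assms(1) by (intro diff_less_mono power_strict_increasing) auto
    with less.prems have "q ^ N - 1 = 0" by (meson dvd_imp_le not_less zero_less_iff_neq_zero)
    moreover have "q ^ N > 0" using assms(1) by simp
    ultimately have "q ^ N = 1" by linarith
    then have "N = 0" using assms(1) by (simp add: nat_power_eq_Suc_0_iff)
    then show ?thesis by simp
  next
    case False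
    then obtain M where M: "N = k + M" using le_Suc_ex by fastforce
    have "q ^ N - 1 = (q ^ k - 1) * q ^ M + (q ^ M - 1)"
      using assms(1) by (simp add: M power_add diff_mult_distrib)
    with less.prems have "q ^ k - 1 dvd q ^ M - 1" by (metis dvd_add_right_iff dvd_triv_left)
    then show ?thesis using less.IH[of M] assms(2) M by simp
  qed
qed

section \<open>Wedderburn's little theorem\<close>

definition centralizer :: "'d::ring \<Rightarrow> 'd set" where
  "centralizer c = {z. z * c = c * z}"

lemma inverse_mult_cancel:
  fixes g y :: "'d::division_ring"
  assumes "g \<noteq> 0"
  shows "g * (inverse g * y) = y" "inverse g * (g * y) = y"
  using assms mult.assoc[of g "inverse g" y] mult.assoc[of "inverse g" g y] by simp_all

section \<open>Conjugacy classes in a division ring\<close>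

definition conj_class :: "'d::division_ring \<Rightarrow> 'd set" where
  "conj_class x = (\<lambda>g. g * x * inverse g) ` (UNIV - {0})"

lemma conj_eq_iff:
  fixes g h x :: "'d::division_ring"
  assumes "g \<noteq> 0" "h \<noteq> 0"
  shows "g * x * inverse g = h * x * inverse h \<longleftrightarrow> inverse h * g \<in> centralizer x"
proof -
  have "g * x * inverse g = h * x * inverse h \<longleftrightarrow>
        inverse h * ((g * x * inverse g) * g) = inverse h * ((h * x * inverse h) * g)"
    using assms by simp
  also have "inverse h * ((g * x * inverse g) * g) = inverse h * g * x"
    using assms by (simp add: mult.assoc)
  also have "inverse h * ((h * x * inverse h) * g) = x * (inverse h * g)"
    using assms by (simp add: mult.assoc inverse_mult_cancel)
  finally show ?thesis by (simp add: centralizer_def)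
qed

text \<open>Orbit-stabilizer: the fibres of \<open>g\<close> -> \<open>g * x * inverse g\<close> on
  nonzero elements are the cosets \<open>h * (centralizer x - {0})\<close>, all of the same
  size.\<close>

lemma card_conj_class:
  fixes x :: "'d::division_ring"
  assumes "finite (UNIV :: 'd set)"
  shows "card (conj_class x) * (card (centralizer x) - 1) = card (UNIV :: 'd set) - 1"
proof -
  let ?G = "UNIV - {0::'d}" and ?f = "\<lambda>g. g * x * inverse g"
  have fin: "finite A" for A :: "'d set" using finite_subset[OF subset_UNIV assms] .
  have fibre: "card {g \<in> ?G. ?f g = y} = card (centralizer x) - 1" if y: "y \<in> conj_class x" for y
  proof -
    obtain h where h: "h \<noteq> 0" "y = ?f h" using y by (auto simp: conj_class_def)
    have "{g \<in> ?G. ?f g = y} = (\<lambda>z. h * z) ` (centralizer x - {0})"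
    proof (intro equalityI subsetI)
      fix g assume g: "g \<in> {g \<in> ?G. ?f g = y}"
      then have "inverse h * g \<in> centralizer x"
        using h conj_eq_iff[of g h x] by simp
      moreover have "inverse h * g \<noteq> 0" using g h by simp
      moreover have "g = h * (inverse h * g)" by (simp add: inverse_mult_cancel h)
      ultimately show "g \<in> (\<lambda>z. h * z) ` (centralizer x - {0})" by blast
    next
      fix g assume "g \<in> (\<lambda>z. h * z) ` (centralizer x - {0})"
      then obtain z where z: "z \<in> centralizer x" "z \<noteq> 0" "g = h * z" by blast
      then have "g \<noteq> 0" "inverse h * g \<in> centralizer x"
        using h by (simp_all add: inverse_mult_cancel)
      then show "g \<in> {g \<in> ?G. ?f g = y}" using h conj_eq_iff[of g h x] by simp
    qed
    also have "card \<dots> = card (centralizer x - {0})"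
      using h by (intro card_image) (simp add: inj_on_def)
    also have "\<dots> = card (centralizer x) - 1"
      by (rule card_Diff_singleton) (simp add: centralizer_def)
    finally show ?thesis .
  qed
  have "card ?G = (\<Sum>y\<in>conj_class x. card {g \<in> ?G. ?f g = y})"
    unfolding card_eq_sum
    by (rule sum.group[symmetric]) (use fin in \<open>simp_all add: conj_class_def\<close>)
  also have "\<dots> = card (conj_class x) * (card (centralizer x) - 1)" using fibre by simp
  finally show ?thesis using fin by simp
qed

lemma conj_class_self: "x \<in> conj_class (x :: 'd::division_ring)"
  unfolding conj_class_def by (rule image_eqI[of _ _ 1]) auto

lemma conj_class_trans:
  assumes "y \<in> conj_class (x :: 'd::division_ring)" "z \<in> conj_class y"
  shows "z \<in> conj_class x"
proof -
  obtain g h where *: "g \<noteq> 0" "y = g * x * inverse g" "h \<noteq> 0" "z = h * y * inverse h"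
    using assms by (auto simp: conj_class_def)
  then have "z = (h * g) * x * inverse (h * g)"
    by (simp add: nonzero_inverse_mult_distrib mult.assoc)
  then show ?thesis using * unfolding conj_class_def by (intro image_eqI[of _ _ "h * g"]) auto
qed

lemma conj_class_sym:
  assumes "y \<in> conj_class (x :: 'd::division_ring)"
  shows "x \<in> conj_class y"
proof -
  obtain g where *: "g \<noteq> 0" "y = g * x * inverse g" using assms by (auto simp: conj_class_def)
  then have "inverse g * y * inverse (inverse g) = x"
    by (simp add: mult.assoc inverse_mult_cancel)
  then show ?thesis using * unfolding conj_class_def by (intro image_eqI[of _ _ "inverse g"]) auto
qed

lemma conj_class_eq_iff: "conj_class y = conj_class x \<longleftrightarrow> y \<in> conj_class (x :: 'd::division_ring)"
  using conj_class_self conj_class_trans conj_class_sym by blast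

lemma conj_class_center:
  assumes "x \<notin> ring_center" "y \<in> conj_class (x :: 'd::division_ring)"
  shows "y \<notin> ring_center"
proof
  assume "y \<in> ring_center"
  moreover obtain g where "g \<noteq> 0" "x = g * y * inverse g"
    using conj_class_sym[OF assms(2)] by (auto simp: conj_class_def)
  ultimately have "x = y" by (auto simp: ring_center_def mult.assoc inverse_mult_cancel)
  with \<open>y \<in> ring_center\<close> assms(1) show False by simp
qed

context central_division_algebra
begin

section \<open>Counting subspaces over a finite field\<close>

lemma card_span_independent:
  assumes "finite B" "independent B" "finite (UNIV :: 'f set)"
  shows "card (span B) = card (UNIV :: 'f set) ^ card B"
  using assms(1,2)
proof (induction B)
  case (insert b B)
  have b: "b \<notin> span B" and B: "independent B"
    using insert.prems insert.hyps by (auto simp: independent_insert)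
  let ?f = "\<lambda>(c, v). scale c b + v"
  have "span (insert b B) = ?f ` (UNIV \<times> span B)"
  proof (intro equalityI subsetI)
    fix x assume "x \<in> span (insert b B)"
    then obtain k where "x - scale k b \<in> span B" by (auto simp: span_insert)
    then show "x \<in> ?f ` (UNIV \<times> span B)"
      by (intro image_eqI[of _ _ "(k, x - scale k b)"]) auto
  next
    fix x assume "x \<in> ?f ` (UNIV \<times> span B)"
    then show "x \<in> span (insert b B)"
      by (auto intro!: span_add span_scale intro: span_base span_mono[THEN subsetD, rotated])
  qed
  moreover have "inj_on ?f (UNIV \<times> span B)"
  proof (rule inj_onI, clarify)
    fix c v c' v' assume *: "v \<in> span B" "v' \<in> span B" "scale c b + v = scale c' b + v'"
    have "scale (c - c') b = v' - v" using *(3) by (simp add: scale_left_diff_distrib algebra_simps)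
    then have "scale (c - c') b \<in> span B" using *(1,2) by (simp add: span_diff)
    then have "c = c'" using b span_scale[of "scale (c - c') b" B "inverse (c - c')"] by (cases "c = c'") auto
    then show "c = c' \<and> v = v'" using *(3) by simp
  qed
  ultimately have "card (span (insert b B)) = card (UNIV :: 'f set) * card (span B)"
    by (simp add: card_image card_cartesian_product)
  then show ?case using insert B by simp
qed simp

lemma card_subspace:
  assumes "subspace V" "finite (UNIV :: 'f set)"
  shows "\<exists>k. card V = card (UNIV :: 'f set) ^ k"
proof -
  obtain B where "B \<subseteq> V" "independent B" "V \<subseteq> span B" using basis_exists by metis
  moreover obtain B0 where "finite B0" "span B0 = (UNIV :: 'd set)" using finite_dim by blast
  ultimately have "finite B" "V = span B"
    using independent_span_bound[of B0 B] assms(1) span_minimal by (auto simp: subset_antisym)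
  then show ?thesis using card_span_independent[OF _ \<open>independent B\<close> assms(2)] by auto
qed

lemma subspace_centralizer: "subspace (centralizer x)"
  by (auto simp: subspace_def centralizer_def distrib_left distrib_right scale_mult_left scale_mult_right)

lemma inj_scale_one: "inj (\<lambda>a. scale a 1)"
  by (auto intro!: injI)

text \<open>Witt's argument. The noncentral elements number \<open>q^N - q\<close> and fall into
  conjugacy classes of size \<open>(q^N - 1) / (q^k - 1)\<close> with \<open>k < N\<close> and
  \<open>k dvd N\<close>, each divisible by \<open>Q\<close>. As \<open>Q\<close> also divides
  \<open>q^N - 1\<close>, it divides \<open>q - 1\<close>, against
  \<open>\<bar>Q\<bar> > q - 1\<close>.\<close>

theorem wedderburn_little:
  assumes fin: "finite (UNIV :: 'f set)"
  shows "ring_center = (UNIV :: 'd set)"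
proof (rule ccontr)
  assume non: "ring_center \<noteq> (UNIV :: 'd set)"
  define q where "q = card (UNIV :: 'f set)"
  have "{0, 1} \<subseteq> (UNIV :: 'f set)" by simp
  then have q: "q \<ge> 2" unfolding q_def using fin card_mono[of "UNIV :: 'f set" "{0, 1}"] by simp
  obtain N where N: "card (UNIV :: 'd set) = q ^ N"
    using card_subspace[OF subspace_UNIV fin] by (auto simp: q_def)
  have finD: "finite (UNIV :: 'd set)" using N q by (intro card_ge_0_finite) simp
  have fin': "finite A" for A :: "'d set" using finite_subset[OF subset_UNIV finD] .
  have cardF: "card (ring_center :: 'd set) = q"
    unfolding center_eq_scalars scalars_def q_def using card_image[OF inj_scale_one] by simp
  have "card (ring_center :: 'd set) < card (UNIV :: 'd set)"
    using non fin' by (intro psubset_card_mono) auto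
  then have "q ^ 1 < q ^ N" using N cardF by simp
  then have N2: "N \<ge> 2" using q by (subst (asm) power_strict_increasing_iff) auto
  obtain Q :: int where Q: "\<bar>Q\<bar> > int q - 1" "Q dvd int q ^ N - 1"
    "\<And>k. 0 < k \<Longrightarrow> k < N \<Longrightarrow> k dvd N \<Longrightarrow> \<exists>r. int q ^ N - 1 = (int q ^ k - 1) * (Q * r)"
    using ex_cyclotomic_value[OF q N2] by blast
  have dvd_class: "Q dvd int (card (conj_class x))" if x: "x \<notin> ring_center" for x :: 'd
  proof -
    obtain k where k: "card (centralizer x) = q ^ k"
      using card_subspace[OF subspace_centralizer fin] by (auto simp: q_def)
    have "ring_center \<subseteq> centralizer x" by (auto simp: ring_center_def centralizer_def)
    then have "q \<le> q ^ k" using card_mono[OF fin', of ring_center "centralizer x"] cardF k by simp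
    then have k0: "k > 0" using q by (cases k) auto
    \<comment> \<open>Noncentrality of \<open>x\<close> makes its centralizer proper, so that
      \<open>k < N\<close>, as \<open>Q(3)\<close> requires.\<close>
    obtain z where "x * z \<noteq> z * x" using x by (auto simp: ring_center_def)
    then have "z \<notin> centralizer x" by (simp add: centralizer_def)
    then have "centralizer x \<noteq> UNIV" by blast
    then have "card (centralizer x) < card (UNIV :: 'd set)"
      using fin' by (intro psubset_card_mono) auto
    then have kN: "k < N" using k N q using power_strict_increasing_iff[of q k N] by simp
    have eq: "card (conj_class x) * (q ^ k - 1) = q ^ N - 1"
      using card_conj_class[OF finD, of x] k N by simp
    then have "k dvd N" using dvd_of_power_minus_1_dvd[OF q k0] by (metis dvd_triv_right)
    then obtain r where r: "int q ^ N - 1 = (int q ^ k - 1) * (Q * r)" using Q(3) k0 kN by blast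
    have "int (card (conj_class x)) * (int q ^ k - 1) = int q ^ N - 1"
      using arg_cong[OF eq, of int] q by (simp add: of_nat_diff)
    then have "(int q ^ k - 1) * int (card (conj_class x)) = (int q ^ k - 1) * (Q * r)" using r by (simp add: mult.commute)
    moreover have "q ^ 1 \<le> q ^ k" using k0 q by (intro power_increasing) auto
    then have "q ^ k > 1" using q by simp
    then have "int (q ^ k) > 1" by linarith
    then have "int q ^ k - 1 \<noteq> 0" by simp
    ultimately show ?thesis by simp
  qed
  let ?S = "UNIV - (ring_center :: 'd set)"
  have "card ?S = (\<Sum>K\<in>conj_class ` ?S. card {x \<in> ?S. conj_class x = K})"
    unfolding card_eq_sum by (rule sum.group[symmetric]) (use fin' in simp_all)
  also have "\<dots> = (\<Sum>K\<in>conj_class ` ?S. card K)"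
  proof (intro sum.cong refl arg_cong[of _ _ card])
    fix K assume "K \<in> conj_class ` ?S"
    then obtain x where x: "x \<notin> ring_center" "K = conj_class x" by blast
    then show "{y \<in> ?S. conj_class y = K} = K"
      using conj_class_center[OF x(1)] by (auto simp: conj_class_eq_iff)
  qed
  finally have "int (card ?S) = (\<Sum>K\<in>conj_class ` ?S. int (card K))" by simp
  then have "Q dvd int (card ?S)" using dvd_class by (auto intro!: dvd_sum)
  also have "int (card ?S) = int q ^ N - int q"
    using N cardF fin' q \<open>q ^ 1 < q ^ N\<close> by (simp add: card_Diff_subset of_nat_diff)
  finally have "Q dvd (int q ^ N - 1) - (int q ^ N - int q)" using Q(2) by (rule dvd_diff[rotated])
  then have "Q dvd int q - 1" by simp
  then have "\<bar>Q\<bar> \<le> \<bar>int q - 1\<bar>" using q by (intro dvd_imp_le_int) auto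
  then show False using Q(1) q by simp
qed

end

section \<open>Generic linear independence\<close>

lemma ex_of_eventually_cofinite:
  "infinite (UNIV :: 'a set) \<Longrightarrow> eventually P (cofinite :: 'a filter) \<Longrightarrow> \<exists>s. P s"
  by (rule eventually_happens') simp_all

context central_division_algebra
begin

text \<open>Independence of a family rather than of a set, so that a repeated vector counts as a
  dependence. For the powers of \<open>d\<close> it says that \<open>d\<close> has degree at least
  \<open>n\<close> over \<open>F\<close>.\<close>

definition lin_indep :: "nat \<Rightarrow> (nat \<Rightarrow> 'd) \<Rightarrow> bool" where
  "lin_indep n v \<longleftrightarrow> inj_on v {..<n} \<and> independent (v ` {..<n})"

lemma lin_indep_Suc:
  "lin_indep (Suc n) v \<longleftrightarrow> lin_indep n v \<and> v n \<notin> span (v ` {..<n})"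
  unfolding lin_indep_def lessThan_Suc
  by (auto simp: independent_insert inj_on_insert intro: span_base split: if_splits)

lemma lin_indep_0 [simp]: "lin_indep 0 v"
  by (simp add: lin_indep_def independent_empty)

lemma span_family_iff:
  fixes v :: "nat \<Rightarrow> 'd"
  shows "x \<in> span (v ` {..<n}) \<longleftrightarrow> (\<exists>c. x = (\<Sum>i<n. scale (c i) (v i)))"
proof
  assume "x \<in> span (v ` {..<n})"
  then show "\<exists>c. x = (\<Sum>i<n. scale (c i) (v i))"
  proof (induction n arbitrary: x)
    case (Suc n)
    then obtain k where "x - scale k (v n) \<in> span (v ` {..<n})"
      by (auto simp: lessThan_Suc span_insert)
    then obtain c where c: "x - scale k (v n) = (\<Sum>i<n. scale (c i) (v i))" using Suc.IH by blast
    have "x = (\<Sum>i<Suc n. scale ((c(n := k)) i) (v i))"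
      using c by (simp add: algebra_simps)
    then show ?case by blast
  qed simp
next
  assume "\<exists>c. x = (\<Sum>i<n. scale (c i) (v i))"
  then show "x \<in> span (v ` {..<n})" by (auto intro: span_sum span_scale span_base)
qed

lemma lin_indep_iff:
  "lin_indep n v \<longleftrightarrow> (\<forall>c. (\<Sum>i<n. scale (c i) (v i)) = 0 \<longrightarrow> (\<forall>i<n. c i = 0))"
proof (induction n)
  case (Suc n)
  show ?case
  proof (intro iffI allI impI)
    fix c i assume li: "lin_indep (Suc n) v" and 0: "(\<Sum>i<Suc n. scale (c i) (v i)) = 0" and i: "i < Suc n"
    have "c n = 0"
    proof (rule ccontr)
      assume n: "c n \<noteq> 0"
      have "scale (c n) (v n) = - (\<Sum>i<n. scale (c i) (v i))" using 0 by (simp add: eq_neg_iff_add_eq_0 add.commute)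
      also have "\<dots> \<in> span (v ` {..<n})" by (intro span_neg span_sum span_scale span_base) auto
      finally have "scale (inverse (c n)) (scale (c n) (v n)) \<in> span (v ` {..<n})" by (rule span_scale)
      then show False using li n by (simp add: lin_indep_Suc)
    qed
    then show "c i = 0" using Suc li 0 i by (simp add: lin_indep_Suc less_Suc_eq) blast
  next
    assume *: "\<forall>c. (\<Sum>i<Suc n. scale (c i) (v i)) = 0 \<longrightarrow> (\<forall>i<Suc n. c i = 0)"
    have "lin_indep n v"
      unfolding Suc
    proof (intro allI impI)
      fix c i assume "(\<Sum>i<n. scale (c i) (v i)) = 0" "i < n"
      then have "(c(n := 0)) i = 0" using *[rule_format, of "c(n := 0)" i] by simp
      then show "c i = 0" using \<open>i < n\<close> by simp
    qed
    moreover have "v n \<notin> span (v ` {..<n})"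
    proof
      assume "v n \<in> span (v ` {..<n})"
      then obtain c where "v n = (\<Sum>i<n. scale (c i) (v i))" by (auto simp: span_family_iff)
      then have "(c(n := - 1)) n = 0" using *[rule_format, of "c(n := - 1)" n] by simp
      then show False by simp
    qed
    ultimately show "lin_indep (Suc n) v" by (simp add: lin_indep_Suc)
  qed
qed simp

lemma lin_indep_cong:
  assumes "\<And>i. i < n \<Longrightarrow> v i = w i"
  shows "lin_indep n v = lin_indep n w"
proof -
  have "(\<Sum>i<n. scale (c i) (v i)) = (\<Sum>i<n. scale (c i) (w i))" for c
    using assms by (intro sum.cong) auto
  then show ?thesis by (simp add: lin_indep_iff)
qed

lemma lin_indep_bounded: "\<exists>N. \<forall>n v. lin_indep n v \<longrightarrow> n \<le> N"
proof -
  obtain B where B: "finite B" "span B = (UNIV :: 'd set)" using finite_dim by blast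
  have "n \<le> card B" if "lin_indep n v" for n v
    using independent_span_bound[of B "v ` {..<n}"] B that by (simp add: lin_indep_def card_image)
  then show ?thesis by blast
qed

section \<open>Polynomial functions of a parameter\<close>

lemma ex_functional:
  assumes "x \<noteq> 0"
  obtains f :: "'d \<Rightarrow> 'f" where "f x \<noteq> 0" "\<And>y z. f (y + z) = f y + f z" "\<And>a y. f (scale a y) = a * f y"
proof -
  obtain B :: "'d set" where B: "independent B" "span B = UNIV"
    using basis_exists[of UNIV] by (metis top.extremum_uniqueI)
  have "\<exists>b. representation B x b \<noteq> 0"
  proof (rule ccontr)
    assume "\<not> ?thesis"
    then have "x = 0" using sum_nonzero_representation_eq[OF B(1), of x] B(2) by simp
    with assms show False by simp
  qed
  then obtain b where "representation B x b \<noteq> 0" by blast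
  then show ?thesis
    by (rule that) (use B in \<open>simp_all add: representation_add representation_scale\<close>)
qed

text \<open>The polynomials in \<open>s\<close> with coefficients in \<open>D\<close>, as functions.
  The rules follow Horner's scheme, so that closure properties come by rule induction.\<close>

inductive poly_fun :: "('f \<Rightarrow> 'd) \<Rightarrow> bool" where
  const: "poly_fun (\<lambda>_. x)"
| add: "poly_fun f \<Longrightarrow> poly_fun g \<Longrightarrow> poly_fun (\<lambda>s. f s + g s)"
| scale: "poly_fun f \<Longrightarrow> poly_fun (\<lambda>s. scale s (f s))"

lemma poly_fun_mult_const: "poly_fun f \<Longrightarrow> poly_fun (\<lambda>s. x * f s)"
  by (induction rule: poly_fun.induct)
     (auto simp: distrib_left scale_mult_right intro: poly_fun.intros)

lemma poly_fun_mult: "poly_fun f \<Longrightarrow> poly_fun g \<Longrightarrow> poly_fun (\<lambda>s. f s * g s)"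
  by (induction rule: poly_fun.induct)
     (auto simp: distrib_right scale_mult_left intro: poly_fun.intros poly_fun_mult_const)

lemma poly_fun_power: "poly_fun f \<Longrightarrow> poly_fun (\<lambda>s. f s ^ n)"
  by (induction n) (auto intro: poly_fun.const poly_fun_mult)

lemma poly_fun_sum: "(\<And>i. i \<in> A \<Longrightarrow> poly_fun (f i)) \<Longrightarrow> poly_fun (\<lambda>s. \<Sum>i\<in>A. f i s)"
  by (induction A rule: infinite_finite_induct) (auto intro: poly_fun.const poly_fun.add)

lemma scale_one_mult: "scale a 1 * x = scale a x"
  by (simp add: scale_mult_left)

lemma poly_fun_scale_const: "poly_fun f \<Longrightarrow> poly_fun (\<lambda>s. scale a (f s))"
  using poly_fun_mult_const[of f "scale a 1"] by (simp add: scale_one_mult)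

lemma poly_fun_diff: "poly_fun f \<Longrightarrow> poly_fun g \<Longrightarrow> poly_fun (\<lambda>s. f s - g s)"
  using poly_fun.add[of f "\<lambda>s. scale (-1) (g s)"] poly_fun_scale_const[of g "-1"] by simp

lemma poly_fun_scale_poly: "poly_fun f \<Longrightarrow> poly_fun (\<lambda>s. scale (poly q s) (f s))"
proof (induction q)
  case 0
  then show ?case using poly_fun.const[of 0] by simp
next
  case (pCons a q)
  then have "poly_fun (\<lambda>s. scale a (f s) + scale s (scale (poly q s) (f s)))"
    by (intro poly_fun.add poly_fun.scale poly_fun_scale_const)
  then show ?case by (simp add: scale_left_distrib)
qed

lemma poly_fun_functional:
  assumes "poly_fun g" "\<And>y z. f (y + z) = f y + f z" "\<And>a y. f (scale a y) = a * f y"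
  shows "\<exists>q. \<forall>s. f (g s) = poly q s"
  using assms(1)
proof (induction rule: poly_fun.induct)
  case (const x)
  show ?case by (rule exI[of _ "[:f x:]"]) simp
next
  case (add g h)
  then obtain p q where "\<forall>s. f (g s) = poly p s" "\<forall>s. f (h s) = poly q s" by blast
  then show ?case by (intro exI[of _ "p + q"]) (simp add: assms(2))
next
  case (scale g)
  then obtain p where "\<forall>s. f (g s) = poly p s" by blast
  then show ?case by (intro exI[of _ "pCons 0 p"]) (simp add: assms(3))
qed

text \<open>Elimination of the last vector by a functional \<open>f\<close> not vanishing on it replaces minors.\<close>
lemma lin_indep_cofinite:
  assumes "\<And>i. i < n \<Longrightarrow> poly_fun (v i)" "lin_indep n (\<lambda>i. v i s0)"
  shows "eventually (\<lambda>s. lin_indep n (\<lambda>i. v i s)) cofinite"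
  using assms
proof (induction n arbitrary: v)
  case (Suc n)
  have "v n s0 \<noteq> 0"
    using Suc.prems(2) span_zero by (auto simp: lin_indep_Suc)
  then obtain f where f: "f (v n s0) \<noteq> 0" "\<And>y z. f (y + z) = f y + f z" "\<And>a y. f (scale a y) = a * f y"
    using ex_functional by metis
  have f0: "f 0 = 0" using f(3)[of 0 0] by simp
  have f_sum: "f (\<Sum>i\<in>A. h i) = (\<Sum>i\<in>A. f (h i))" for h and A :: "nat set"
    by (induction A rule: infinite_finite_induct) (auto simp: f0 f(2))
  \<comment> \<open>\<open>w i\<close> is \<open>v i\<close> with its component along
    \<open>v n\<close> removed so that \<open>f (w i s) = 0\<close>; multiplying by
    \<open>f (v n s)\<close> instead of dividing keeps it polynomial in \<open>s\<close>.\<close>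
  define w where "w i s = scale (f (v n s)) (v i s) - scale (f (v i s)) (v n s)" for i s
  have combo: "(\<Sum>i<n. scale (c i) (w i s)) =
      scale (f (v n s)) (\<Sum>i<n. scale (c i) (v i s)) - scale (f (\<Sum>i<n. scale (c i) (v i s))) (v n s)" for c s
    by (simp add: w_def scale_right_diff_distrib sum_subtractf scale_sum_right f_sum f(3) scale_sum_left mult.commute)
  obtain q where q: "\<And>i s. i < Suc n \<Longrightarrow> f (v i s) = poly (q i) s"
    using poly_fun_functional[OF Suc.prems(1) f(2,3)] by metis
  have "poly_fun (w i)" if "i < n" for i
  proof -
    have "poly_fun (\<lambda>s. scale (poly (q n) s) (v i s) - scale (poly (q i) s) (v n s))"
      using that Suc.prems(1) by (intro poly_fun_diff poly_fun_scale_poly) auto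
    then show ?thesis using that by (simp add: w_def[abs_def] q)
  qed
  moreover have "lin_indep n (\<lambda>i. w i s0)"
    unfolding lin_indep_iff
  proof (rule allI, rule impI)
    fix c assume "(\<Sum>i<n. scale (c i) (w i s0)) = 0"
    then have eq: "scale (f (v n s0)) (\<Sum>i<n. scale (c i) (v i s0)) = scale (f (\<Sum>i<n. scale (c i) (v i s0))) (v n s0)"
      by (simp add: combo)
    \<comment> \<open>A relation among the \<open>w i s0\<close>, rewritten in terms of the
      \<open>v i s0\<close>: the first \<open>n\<close> coefficients are those of \<open>c\<close>
      times the nonzero \<open>f (v n s0)\<close>.\<close>
    let ?c = "\<lambda>i. if i = n then - f (\<Sum>i<n. scale (c i) (v i s0)) else f (v n s0) * c i"
    have "(\<Sum>i<Suc n. scale (?c i) (v i s0)) = 0"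
      using eq by (simp add: scale_sum_right flip: scale_scale)
    then have "\<forall>i<Suc n. ?c i = 0"
      using Suc.prems(2) unfolding lin_indep_iff by (elim allE[of _ ?c]) simp
    then show "\<forall>i<n. c i = 0" using f(1) by (metis less_SucI less_irrefl mult_eq_0_iff)
  qed
  ultimately have ev1: "eventually (\<lambda>s. lin_indep n (\<lambda>i. w i s)) cofinite"
    by (rule Suc.IH)
  \<comment> \<open>\<open>f (v n s)\<close> is a nonzero polynomial in \<open>s\<close>, so it
    vanishes only finitely often.\<close>
  have "q n \<noteq> 0" using f(1) q[of n s0] by auto
  then have ev2: "eventually (\<lambda>s. f (v n s) \<noteq> 0) cofinite"
    using poly_roots_finite[of "q n"] by (simp add: eventually_cofinite q)
  from ev1 ev2 show ?case
  proof eventually_elim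
    case (elim s)
    show ?case
      unfolding lin_indep_iff
    proof (rule allI, rule impI)
      fix c assume 0: "(\<Sum>i<Suc n. scale (c i) (v i s)) = 0"
      then have eq: "(\<Sum>i<n. scale (c i) (v i s)) = - scale (c n) (v n s)"
        by (simp add: eq_neg_iff_add_eq_0)
      \<comment> \<open>Applying \<open>f\<close> to the relation determines \<open>c n\<close>, and
        the relation passes to the \<open>w i s\<close>.\<close>
      have "f (- scale (c n) (v n s)) = - c n * f (v n s)"
        using f(3)[of "- c n" "v n s"] by simp
      then have "(\<Sum>i<n. scale (c i) (w i s)) = 0"
        unfolding combo eq by (simp add: mult.commute)
      then have c: "\<forall>i<n. c i = 0" using elim(1) by (simp add: lin_indep_iff)
      then have "scale (c n) (v n s) = 0" using 0 by simp
      then have "c n = 0" using elim(2) f0 by auto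
      with c show "\<forall>i<Suc n. c i = 0" by (auto simp: less_Suc_eq)
    qed
  qed
qed simp

end

section \<open>Additive commutators of maximal degree\<close>

lemma mult_mem_centralizer: "y \<in> centralizer x \<Longrightarrow> z \<in> centralizer x \<Longrightarrow> y * z \<in> centralizer x"
  unfolding centralizer_def mem_Collect_eq by (metis mult.assoc)

lemma inverse_mem_centralizer: "y \<in> centralizer x \<Longrightarrow> inverse y \<in> centralizer (x :: 'd::division_ring)"
  by (simp add: centralizer_def inverse_commute)

lemma power_mem_centralizer: "x ^ i \<in> centralizer (x :: 'd::ring_1)"
  by (simp add: centralizer_def power_commutes)

text \<open>For \<open>x = d + scale s e\<close> one has
  \<open>x ^ i = d ^ i + scale s (diff_quot x d e i)\<close>, exactly and not only to first order.
  At \<open>x = d\<close> this is the derivative of the \<open>i\<close>-th power in direction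
  \<open>e\<close>.\<close>

primrec diff_quot :: "'d::ring_1 \<Rightarrow> 'd \<Rightarrow> 'd \<Rightarrow> nat \<Rightarrow> 'd" where
  "diff_quot x d e 0 = 0"
| "diff_quot x d e (Suc i) = x * diff_quot x d e i + e * d ^ i"

lemma diff_quot_eq_sum: "diff_quot d d e i = (\<Sum>j<i. d ^ j * e * d ^ (i - 1 - j))"
proof (induction i)
  case (Suc i)
  have "(\<Sum>j<Suc i. d ^ j * e * d ^ (Suc i - 1 - j)) = e * d ^ i + (\<Sum>j<i. d ^ Suc j * e * d ^ (i - 1 - j))"
    by (subst sum.lessThan_Suc_shift) simp
  then show ?case by (simp add: Suc sum_distrib_left mult.assoc add.commute)
qed simp

lemma diff_quot_diff: "diff_quot d d (x - y) i = diff_quot d d x i - diff_quot d d y i"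
proof (induction i)
  case (Suc i)
  then show ?case by (simp add: right_diff_distrib left_diff_distrib)
qed simp

text \<open>\<open>z\<close> moves to the front past every left factor \<open>d\<close>. This makes
  the image of the derivative a left ideal of the centralizer.\<close>

lemma diff_quot_mult_left:
  assumes "z \<in> centralizer d"
  shows "diff_quot d d (z * e) i = z * diff_quot d d e i"
proof (induction i)
  case (Suc i)
  have "d * (z * q) = z * (d * q)" for q
    using assms by (metis (mono_tags) centralizer_def mem_Collect_eq mult.assoc)
  with Suc show ?case by (simp add: distrib_left mult.assoc)
qed simp

lemma diff_quot_telescope: "d * diff_quot d d e i - diff_quot d d e i * d = d ^ i * e - e * d ^ i"
proof (induction i)
  case (Suc i)
  let ?q = "diff_quot d d e i"
  have "d * (d * ?q + e * d ^ i) - (d * ?q + e * d ^ i) * d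
      = d * (d * ?q - ?q * d) + d * (e * d ^ i) - e * (d ^ i * d)"
    by (simp add: algebra_simps)
  also have "\<dots> = d * (d ^ i * e) - e * (d ^ i * d)"
    unfolding Suc by (simp add: algebra_simps)
  finally show ?case by (simp add: mult.assoc power_commutes)
qed simp

text \<open>A commuting derivation of a division ring vanishes (Posner), applied to \<open>[-, b]\<close>.\<close>
lemma ex_double_commutator:
  fixes b :: "'d::division_ring"
  assumes "b \<notin> ring_center"
  shows "\<exists>u. u * (u * b - b * u) - (u * b - b * u) * u \<noteq> 0"
proof (rule ccontr)
  define \<delta> where "\<delta> u = u * b - b * u" for u
  assume "\<not> ?thesis"
  then have comm: "u * \<delta> u = \<delta> u * u" for u by (simp add: \<delta>_def)
  have \<delta>_add: "\<delta> (u + v) = \<delta> u + \<delta> v" and \<delta>_mult: "\<delta> (u * v) = \<delta> u * v + u * \<delta> v" for u v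
    by (simp_all add: \<delta>_def algebra_simps)
  \<comment> \<open>Polarization of \<open>comm\<close> at \<open>u + v\<close>.\<close>
  have lin: "u * \<delta> v + v * \<delta> u = \<delta> v * u + \<delta> u * v" for u v
    using comm[of "u + v"] comm[of u] comm[of v] by (simp add: \<delta>_add algebra_simps)
  \<comment> \<open>Subtract \<open>u\<close> times \<open>lin\<close> for \<open>u, v\<close> from
    \<open>lin\<close> for \<open>u, u * v\<close>, and use that \<open>u\<close> commutes with
    \<open>\<delta> u\<close>.\<close>
  have zero: "\<delta> u * (u * v - v * u) = 0" for u v
  proof -
    have "u * (\<delta> u * v + u * \<delta> v) + u * v * \<delta> u = (\<delta> u * v + u * \<delta> v) * u + \<delta> u * (u * v)"
      using lin[of u "u * v"] by (simp add: \<delta>_mult)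
    moreover have "u * (u * \<delta> v + v * \<delta> u) = u * (\<delta> v * u + \<delta> u * v)" by (simp only: lin)
    moreover have "u * (\<delta> u * v) = \<delta> u * (u * v)" by (metis comm mult.assoc)
    ultimately show ?thesis by (auto simp: algebra_simps)
  qed
  \<comment> \<open>A \<open>u\<close> with \<open>\<delta> u \<noteq> 0\<close> would be central by
    \<open>zero\<close>, as there are no zero divisors; but then
    \<open>\<delta> u = 0\<close>.\<close>
  obtain u where "b * u \<noteq> u * b" using assms by (auto simp: ring_center_def)
  then have u: "\<delta> u \<noteq> 0" by (auto simp: \<delta>_def)
  then have "u * v = v * u" for v using zero[of u v] by simp
  then show False using u by (simp add: \<delta>_def)
qed

context central_division_algebra
begin

text \<open>Shortening of relations: normalize \<open>w n\<close> to 1, replace \<open>y\<close> by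
  \<open>y * z\<close> and subtract the relation times \<open>z\<close>. The last term cancels, so
  by induction each remaining coefficient commutes with every \<open>z\<close> and lies in
  \<open>F\<close>; then \<open>y = 1\<close> yields a linear relation among the
  \<open>a i\<close>.\<close>

lemma mult_operators_independent:
  assumes "lin_indep n a" "\<And>y. (\<Sum>i<n. a i * y * w i) = 0" "i < n"
  shows "w i = 0"
  using assms
proof (induction n arbitrary: w i)
  case (Suc n)
  have li: "lin_indep n a" using Suc.prems(1) by (simp add: lin_indep_Suc)
  have "w n = 0"
  proof (rule ccontr)
    assume wn: "w n \<noteq> 0"
    define w' where "w' i = w i * inverse (w n)" for i
    have w'n: "w' n = 1" using wn by (simp add: w'_def)
    have "(\<Sum>i<Suc n. a i * y * w' i) = (\<Sum>i<Suc n. a i * y * w i) * inverse (w n)" for y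
      unfolding sum_distrib_right by (intro sum.cong) (simp_all add: w'_def mult.assoc)
    then have w': "(\<Sum>i<n. a i * y * w' i) = - (a n * y)" for y
      using Suc.prems(2)[of y] w'n by (simp add: eq_neg_iff_add_eq_0)
    have "z * w' i - w' i * z = 0" if i: "i < n" for z i
    proof (rule Suc.IH[OF li _ i])
      fix y
      have "(\<Sum>i<n. a i * y * (z * w' i - w' i * z)) = (\<Sum>i<n. a i * (y * z) * w' i) - (\<Sum>i<n. a i * y * w' i) * z"
        by (simp add: right_diff_distrib sum_subtractf sum_distrib_right mult.assoc)
      also have "\<dots> = 0" unfolding w' by (simp add: mult.assoc)
      finally show "(\<Sum>i<n. a i * y * (z * w' i - w' i * z)) = 0" .
    qed
    then have "w' i \<in> scalars scale" if "i < n" for i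
      using that by (simp add: ring_center_def flip: center_eq_scalars)
    then have "\<exists>k. \<forall>i<n. w' i = scale (k i) 1" unfolding scalars_def by (intro choice) blast
    then obtain k where k: "\<And>i. i < n \<Longrightarrow> w' i = scale (k i) 1" by blast
    have "(\<Sum>i<n. scale (k i) (a i)) = (\<Sum>i<n. a i * 1 * w' i)"
      by (intro sum.cong) (simp_all add: k scale_mult_right)
    then have "(\<Sum>i<n. scale (k i) (a i)) = - a n" using w'[of 1] by simp
    then have "(\<Sum>i<Suc n. scale ((k(n := 1)) i) (a i)) = 0" by simp
    then have "(k(n := 1)) n = 0" using Suc.prems(1) unfolding lin_indep_iff by blast
    then show False by simp
  qed
  then have "(\<Sum>i<n. a i * y * w i) = 0" for y using Suc.prems(2)[of y] by simp
  then show ?case using Suc.IH[OF li] \<open>w n = 0\<close> Suc.prems(3) by (auto simp: less_Suc_eq)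
qed simp

section \<open>The derivative of a polynomial at an element of \<open>D\<close>\<close>

definition poly_diff :: "(nat \<Rightarrow> 'f) \<Rightarrow> nat \<Rightarrow> 'd \<Rightarrow> 'd \<Rightarrow> 'd" where
  "poly_diff c m d e = (\<Sum>i\<le>m. scale (c i) (diff_quot d d e i))"

lemma poly_diff_diff: "poly_diff c m d (x - y) = poly_diff c m d x - poly_diff c m d y"
  by (simp add: poly_diff_def diff_quot_diff scale_right_diff_distrib sum_subtractf)

lemma poly_diff_mult_left:
  "z \<in> centralizer d \<Longrightarrow> poly_diff c m d (z * e) = z * poly_diff c m d e"
  by (simp add: poly_diff_def diff_quot_mult_left sum_distrib_left scale_mult_right)

text \<open>By telescoping, the commutator of \<open>d\<close> with the derivative in direction
  \<open>e\<close> is the commutator of \<open>p(d)\<close> with \<open>e\<close>, and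
  \<open>p(d) = 0\<close>.\<close>

lemma poly_diff_mem_centralizer:
  assumes "(\<Sum>i\<le>m. scale (c i) (d ^ i)) = 0"
  shows "poly_diff c m d e \<in> centralizer d"
proof -
  have "d * poly_diff c m d e - poly_diff c m d e * d
      = (\<Sum>i\<le>m. scale (c i) (d * diff_quot d d e i - diff_quot d d e i * d))"
    by (simp add: poly_diff_def sum_distrib_left sum_distrib_right scale_mult_right scale_mult_left
        scale_right_diff_distrib sum_subtractf)
  also have "\<dots> = (\<Sum>i\<le>m. scale (c i) (d ^ i)) * e - e * (\<Sum>i\<le>m. scale (c i) (d ^ i))"
    unfolding diff_quot_telescope
    by (simp add: sum_distrib_left sum_distrib_right scale_mult_right scale_mult_left
        scale_right_diff_distrib sum_subtractf)
  finally show ?thesis using assms by (simp add: centralizer_def)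
qed

text \<open>Collecting by left powers of \<open>d\<close> turns the derivative into the sum of
  \<open>d ^ j * e * w j\<close> over \<open>j < m\<close>. The powers are independent and the last
  coefficient is \<open>w (m - 1) = c m = 1\<close>, so this operator cannot vanish.\<close>

lemma poly_diff_nonzero:
  assumes "lin_indep m (\<lambda>i. d ^ i)" "c m = 1" "m > 0"
  shows "\<exists>e. poly_diff c m d e \<noteq> 0"
proof (rule ccontr)
  assume "\<not> ?thesis"
  then have zero: "poly_diff c m d e = 0" for e by blast
  define w where "w j = (\<Sum>i | i \<in> {..m} \<and> j < i. scale (c i) (d ^ (i - 1 - j)))" for j
  have "(\<Sum>j<m. d ^ j * e * w j) = poly_diff c m d e" for e
  proof -
    have "poly_diff c m d e = (\<Sum>i\<in>{..m}. \<Sum>j | j \<in> {..<m} \<and> j < i. scale (c i) (d ^ j * e * d ^ (i - 1 - j)))"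
      unfolding poly_diff_def diff_quot_eq_sum scale_sum_right
      by (intro sum.cong refl) auto
    also have "\<dots> = (\<Sum>j<m. \<Sum>i | i \<in> {..m} \<and> j < i. scale (c i) (d ^ j * e * d ^ (i - 1 - j)))"
      by (rule sum.swap_restrict) auto
    also have "\<dots> = (\<Sum>j<m. d ^ j * e * w j)"
      by (simp add: w_def sum_distrib_left scale_mult_right)
    finally show ?thesis ..
  qed
  then have "w (m - 1) = 0"
    using mult_operators_independent[OF assms(1), of w "m - 1"] zero assms(3) by simp
  moreover have "{i. i \<in> {..m} \<and> m - 1 < i} = {m}" using assms(3) by auto
  then have "w (m - 1) = 1" unfolding w_def using assms(2,3) by simp
  ultimately show False by simp
qed

text \<open>A nonzero left ideal of the division ring \<open>centralizer d\<close> is everything: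
  scale a direction with nonzero derivative on the left.\<close>

lemma centralizer_subset_range_poly_diff:
  assumes "lin_indep m (\<lambda>i. d ^ i)" "c m = 1" "m > 0" "(\<Sum>i\<le>m. scale (c i) (d ^ i)) = 0"
    and z: "z \<in> centralizer d"
  shows "\<exists>e. z = poly_diff c m d e"
proof -
  obtain e where e: "poly_diff c m d e \<noteq> 0" using poly_diff_nonzero assms(1-3) by blast
  let ?p = "poly_diff c m d e"
  have "z * inverse ?p \<in> centralizer d"
    using z poly_diff_mem_centralizer[OF assms(4)]
    by (intro mult_mem_centralizer inverse_mem_centralizer)
  then have "poly_diff c m d (z * inverse ?p * e) = z"
    using e by (simp add: poly_diff_mult_left) (simp add: mult.assoc)
  then show ?thesis by metis
qed

lemma span_powers_closed:
  assumes "(\<Sum>i\<le>m. scale (c i) (d ^ i)) = 0" "c m = 1" and x: "x \<in> span ((\<lambda>i. d ^ i) ` {..<m})"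
  shows "d * x \<in> span ((\<lambda>i. d ^ i) ` {..<m})" (is "_ \<in> ?E")
proof -
  have "d ^ m = - (\<Sum>i<m. scale (c i) (d ^ i))"
    using assms(1,2) by (simp add: eq_neg_iff_add_eq_0 add.commute flip: lessThan_Suc_atMost)
  also have "\<dots> \<in> ?E" by (intro span_neg span_sum span_scale span_base) auto
  finally have m: "d ^ m \<in> ?E" .
  from x show ?thesis
  proof (induction rule: span_induct)
    case base
    then show ?case
      by (auto simp: subspace_def distrib_left scale_mult_right span_zero span_add span_scale)
  next
    case (step x)
    then obtain i where i: "x = d ^ i" "i < m" by blast
    then have x: "d * x = d ^ Suc i" by simp
    show ?case
    proof (cases "Suc i = m")
      case False
      then show ?thesis unfolding x using i by (intro span_base imageI) simp
    qed (use m x in simp)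
  qed
qed

text \<open>Since \<open>p(d) = 0\<close>, the value of \<open>p\<close> at
  \<open>x = d + scale s e\<close> is \<open>s\<close> times a polynomial function whose value at
  \<open>s = 0\<close> is the derivative. If that value lay outside \<open>F[d]\<close>, then for
  generic \<open>s \<noteq> 0\<close> the element \<open>p(x)\<close>, hence \<open>x ^ m\<close>,
  would be independent of the lower powers of \<open>x\<close>.\<close>

lemma poly_diff_mem_of_max_degree:
  assumes inf: "infinite (UNIV :: 'f set)"
    and li: "lin_indep m (\<lambda>i. d ^ i)"
    and max: "\<And>s. \<not> lin_indep (Suc m) (\<lambda>i. (d + scale s e) ^ i)"
    and rel: "(\<Sum>i\<le>m. scale (c i) (d ^ i)) = 0" "c m = 1"
  shows "poly_diff c m d e \<in> span ((\<lambda>i. d ^ i) ` {..<m})"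
proof (rule ccontr)
  assume non: "\<not> ?thesis"
  define x where "x s = d + scale s e" for s
  \<comment> \<open>The last entry is \<open>p(x s) / s\<close>, extended to
    \<open>s = 0\<close>.\<close>
  define v where "v i s = (if i < m then x s ^ i else \<Sum>i\<le>m. scale (c i) (diff_quot (x s) d e i))" for i s
  have x_pf: "poly_fun x" unfolding x_def[abs_def] by (intro poly_fun.intros)
  have q_pf: "poly_fun (\<lambda>s. diff_quot (x s) d e i)" for i
    by (induction i) (auto intro!: poly_fun.const poly_fun.add poly_fun_mult x_pf)
  have "poly_fun (v i)" for i
    unfolding v_def[abs_def]
    by (cases "i < m") (auto intro!: poly_fun_power x_pf poly_fun_sum poly_fun_scale_const q_pf)
  moreover have "lin_indep (Suc m) (\<lambda>i. v i 0)"
  proof -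
    have "lin_indep m (\<lambda>i. v i 0)"
      using li by (subst lin_indep_cong[of _ _ "\<lambda>i. d ^ i"]) (auto simp: v_def x_def)
    moreover have "(\<lambda>i. v i 0) ` {..<m} = (\<lambda>i. d ^ i) ` {..<m}" "v m 0 = poly_diff c m d e"
      by (auto simp: v_def x_def poly_diff_def)
    ultimately show ?thesis using non by (simp add: lin_indep_Suc)
  qed
  ultimately have "eventually (\<lambda>s. lin_indep (Suc m) (\<lambda>i. v i s)) cofinite"
    by (rule lin_indep_cofinite)
  moreover have "eventually (\<lambda>s. s \<noteq> (0 :: 'f)) cofinite" by (simp add: eventually_cofinite)
  ultimately have "eventually (\<lambda>s. lin_indep (Suc m) (\<lambda>i. v i s) \<and> s \<noteq> 0) cofinite"
    by (rule eventually_conj)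
  then obtain s where s: "lin_indep (Suc m) (\<lambda>i. v i s)" "s \<noteq> 0"
    using ex_of_eventually_cofinite[OF inf] by blast
  have lim: "lin_indep m (\<lambda>i. x s ^ i)"
    using s(1) by (subst lin_indep_cong[of _ _ "\<lambda>i. v i s"]) (auto simp: v_def lin_indep_Suc)
  have img: "(\<lambda>i. v i s) ` {..<m} = (\<lambda>i. x s ^ i) ` {..<m}" by (auto simp: v_def)
  have pow: "x s ^ i = d ^ i + scale s (diff_quot (x s) d e i)" for i
  proof (induction i)
    case (Suc i)
    have "x s * x s ^ i = x s * d ^ i + scale s (x s * diff_quot (x s) d e i)"
      by (subst Suc) (simp add: distrib_left scale_mult_right)
    then show ?case by (simp add: x_def scale_right_distrib distrib_right scale_mult_left algebra_simps)
  qed simp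
  have "(\<Sum>i\<le>m. scale (c i) (x s ^ i)) = scale s (v m s)"
    unfolding pow by (simp add: scale_right_distrib sum.distrib rel v_def scale_sum_right mult.commute)
  then have vm: "scale s (v m s) = (\<Sum>i<m. scale (c i) (x s ^ i)) + x s ^ m"
    using rel(2) by (simp flip: lessThan_Suc_atMost)
  have "x s ^ m \<notin> span ((\<lambda>i. x s ^ i) ` {..<m})"
  proof
    assume "x s ^ m \<in> span ((\<lambda>i. x s ^ i) ` {..<m})"
    then have "scale s (v m s) \<in> span ((\<lambda>i. x s ^ i) ` {..<m})"
      unfolding vm by (intro span_add span_sum span_scale) (auto intro: span_base)
    then have "scale (inverse s) (scale s (v m s)) \<in> span ((\<lambda>i. x s ^ i) ` {..<m})" by (rule span_scale)
    then show False using s by (simp add: lin_indep_Suc img)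
  qed
  then show False using max[of s] lim by (simp add: lin_indep_Suc x_def)
qed

lemma centralizer_subset_of_max_degree:
  assumes inf: "infinite (UNIV :: 'f set)"
    and d: "d = a * b - b * a" and ad: "a * d \<noteq> d * a"
    and li: "lin_indep m (\<lambda>i. d ^ i)"
    and max: "\<And>y. \<not> lin_indep (Suc m) (\<lambda>i. (a * y - y * a) ^ i)"
  shows "centralizer d \<subseteq> span ((\<lambda>i. d ^ i) ` {..<m})" (is "_ \<subseteq> ?E")
proof
  fix z assume z: "z \<in> centralizer d"
  \<comment> \<open>The family consisting of the zeroth power 1 is always independent, so
    \<open>m = 0\<close> contradicts \<open>max\<close>.\<close>
  have "m > 0"
  proof (rule ccontr)
    assume "\<not> m > 0"
    then show False using max[of b] by (simp add: lin_indep_Suc)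
  qed
  have "d ^ m \<in> ?E" using max[of b] li by (simp add: lin_indep_Suc flip: d)
  then obtain k where k: "d ^ m = (\<Sum>i<m. scale (k i) (d ^ i))" by (auto simp: span_family_iff)
  define c where "c i = (if i < m then - k i else 1)" for i
  have rel: "(\<Sum>i\<le>m. scale (c i) (d ^ i)) = 0" "c m = 1"
    by (simp_all add: c_def k sum_negf flip: lessThan_Suc_atMost)
  let ?\<Delta> = "poly_diff c m d"
  have mem: "?\<Delta> (a * y - y * a) \<in> ?E" for y
  proof (rule poly_diff_mem_of_max_degree[OF inf li _ rel])
    fix s
    \<comment> \<open>Perturbing \<open>d\<close> in a direction \<open>a * y - y * a\<close>
      amounts to perturbing \<open>b\<close>, so maximality among commutators with \<open>a\<close>
      applies.\<close>
    have "d + scale s (a * y - y * a) = a * (b + scale s y) - (b + scale s y) * a"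
      by (simp add: d algebra_simps scale_mult_left scale_mult_right scale_right_diff_distrib)
    then show "\<not> lin_indep (Suc m) (\<lambda>i. (d + scale s (a * y - y * a)) ^ i)"
      using max by simp
  qed
  obtain e where e: "z = ?\<Delta> e"
    using centralizer_subset_range_poly_diff[OF li rel(2) \<open>m > 0\<close> rel(1) z] by blast
  \<comment> \<open>Every direction has the form \<open>(a * d - d * a) * y\<close>, which is a
    commutator with \<open>a\<close> minus \<open>d\<close> times another one.\<close>
  define y where "y = inverse (a * d - d * a) * e"
  have "e = (a * d - d * a) * y" unfolding y_def using ad by (simp add: inverse_mult_cancel)
  also have "\<dots> = (a * (d * y) - d * y * a) - d * (a * y - y * a)"
    by (simp add: algebra_simps)
  finally have "z = ?\<Delta> (a * (d * y) - d * y * a) - d * ?\<Delta> (a * y - y * a)"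
    unfolding e by (simp only: poly_diff_diff[of c m d "a * (d * y) - d * y * a"] poly_diff_mult_left[of d d] centralizer_def mem_Collect_eq)
  then show "z \<in> ?E"
    using mem span_powers_closed[OF rel] by (simp add: span_diff)
qed

end

section \<open>Passage to multiplicative commutators\<close>

lemma sum_lessThan_add:
  fixes f :: "nat \<Rightarrow> 'a::comm_monoid_add"
  shows "(\<Sum>i<n + k. f i) = (\<Sum>i<n. f i) + (\<Sum>j<k. f (n + j))"
  by (induction k) (simp_all add: add.assoc)

lemma mult_geometric_sum:
  fixes y :: "'d::ring_1"
  shows "(1 - y) * (\<Sum>j<i. y ^ j) = 1 - y ^ i"
proof (induction i)
  case (Suc i)
  have "(1 - y) * (\<Sum>j<Suc i. y ^ j) = (1 - y ^ i) + (1 - y) * y ^ i"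
    unfolding sum.lessThan_Suc distrib_left Suc ..
  then show ?case by (simp add: left_diff_distrib)
qed simp

lemma subfield_closed:
  assumes "is_subfield K"
  shows "1 \<in> K" "0 \<in> K" "x \<in> K \<Longrightarrow> y \<in> K \<Longrightarrow> x - y \<in> K" "x \<in> K \<Longrightarrow> y \<in> K \<Longrightarrow> x * y \<in> K"
    "x \<in> K \<Longrightarrow> y \<in> K \<Longrightarrow> x + y \<in> K" "x \<in> K \<Longrightarrow> x ^ n \<in> K"
proof -
  show 1: "1 \<in> K" using assms by (simp add: is_subfield_def)
  have diff: "x - y \<in> K" if "x \<in> K" "y \<in> K" for x y
    using assms that by (simp add: is_subfield_def)
  have mult: "x * y \<in> K" if "x \<in> K" "y \<in> K" for x y
    using assms that by (simp add: is_subfield_def)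
  show 0: "0 \<in> K" using diff[OF 1 1] by simp
  show "x - y \<in> K" if "x \<in> K" "y \<in> K" using that by (rule diff)
  show "x * y \<in> K" if "x \<in> K" "y \<in> K" using that by (rule mult)
  show "x + y \<in> K" if "x \<in> K" "y \<in> K"
    using diff[OF that(1) diff[OF 0 that(2)]] by simp
  show "x ^ n \<in> K" if "x \<in> K" by (induction n) (use that 1 mult in auto)
qed

context central_division_algebra
begin

section \<open>Completing families to bases, and the rank of a commutator map\<close>

lemma lin_indep_mono: "lin_indep n v \<Longrightarrow> k \<le> n \<Longrightarrow> lin_indep k v"
  unfolding lin_indep_def by (meson image_mono independent_mono inj_on_subset lessThan_subset_iff)

lemma lin_indep_extend:
  assumes "lin_indep n v"
  obtains N w where "n \<le> N" "lin_indep N w" "\<And>i. i < n \<Longrightarrow> w i = v i" "span (w ` {..<N}) = UNIV"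
proof -
  let ?P = "\<lambda>N. n \<le> N \<and> (\<exists>w. lin_indep N w \<and> (\<forall>i<n. w i = v i))"
  obtain b where b: "\<And>N w. lin_indep N w \<Longrightarrow> N \<le> b" using lin_indep_bounded by blast
  define N where "N = Greatest ?P"
  have bound: "\<And>M. ?P M \<Longrightarrow> M \<le> b" using b by auto
  have N: "?P N" unfolding N_def by (rule GreatestI_nat[of ?P n b]) (use assms bound in auto)
  have max: "M \<le> N" if "?P M" for M
    unfolding N_def by (rule Greatest_le_nat[of ?P M b]) (use that bound in auto)
  from N obtain w where w: "n \<le> N" "lin_indep N w" "\<And>i. i < n \<Longrightarrow> w i = v i" by blast
  have "x \<in> span (w ` {..<N})" for x
  proof (rule ccontr)
    assume "x \<notin> span (w ` {..<N})"
    moreover have "(w(N := x)) ` {..<N} = w ` {..<N}" by auto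
    moreover have "lin_indep N (w(N := x)) = lin_indep N w" by (rule lin_indep_cong) simp
    ultimately have "lin_indep (Suc N) (w(N := x))" using w(2) by (simp add: lin_indep_Suc)
    then have "?P (Suc N)" using w by (intro conjI exI[of _ "w(N := x)"]) auto
    then show False using max by fastforce
  qed
  then show ?thesis using w that by blast
qed

lemma lin_indep_le_of_span:
  assumes "span (w ` {..<N}) = UNIV" "lin_indep n v"
  shows "n \<le> N"
proof -
  have "card (v ` {..<n}) \<le> card (w ` {..<N})"
    using independent_span_bound[of "w ` {..<N}" "v ` {..<n}"] assms by (simp add: lin_indep_def)
  also have "\<dots> \<le> N" using card_image_le[of "{..<N}" w] by simp
  finally show ?thesis using assms(2) by (simp add: lin_indep_def card_image)
qed

text \<open>Taking the commutator with \<open>g\<close> kills the \<open>p\<close> part of a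
  relation, so the coefficients of the \<open>y j\<close> vanish first.\<close>

lemma lin_indep_append:
  assumes p: "lin_indep n p" "\<And>i. i < n \<Longrightarrow> p i \<in> centralizer g"
    and y: "lin_indep k (\<lambda>j. g * y j - y j * g)"
  shows "lin_indep (n + k) (\<lambda>i. if i < n then p i else y (i - n))"
  unfolding lin_indep_iff
proof (rule allI, rule impI)
  fix c assume "(\<Sum>i<n + k. scale (c i) (if i < n then p i else y (i - n))) = 0"
  then have 0: "(\<Sum>i<n. scale (c i) (p i)) + (\<Sum>j<k. scale (c (n + j)) (y j)) = 0" (is "?p + ?y = 0")
    by (simp add: sum_lessThan_add)
  have "?p \<in> centralizer g"
    using p(2) subspace_centralizer by (intro subspace_sum subspace_scale) auto
  then have "g * ?y - ?y * g = g * (?p + ?y) - (?p + ?y) * g"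
    by (simp add: centralizer_def distrib_left distrib_right)
  then have "g * ?y - ?y * g = 0" by (simp add: 0)
  also have "g * ?y - ?y * g = (\<Sum>j<k. scale (c (n + j)) (g * y j - y j * g))"
    by (simp add: sum_distrib_left sum_distrib_right scale_mult_left scale_mult_right
        scale_right_diff_distrib sum_subtractf)
  finally have cy: "\<forall>j<k. c (n + j) = 0" using y unfolding lin_indep_iff by (elim allE[of _ "\<lambda>j. c (n + j)"]) simp
  then have "?p = 0" using 0 by simp
  then have cp: "\<forall>i<n. c i = 0" using p(1) unfolding lin_indep_iff by blast
  show "\<forall>i<n + k. c i = 0"
  proof (intro allI impI)
    fix i assume "i < n + k"
    then show "c i = 0" using cp cy[rule_format, of "i - n"] by (cases "i < n") auto
  qed
qed

text \<open>The rank of \<open>y \<mapsto> d y - y d\<close> is witnessed by an independent family, which persists under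
  generic deformation of \<open>d\<close>.\<close>
lemma centralizer_rank_witness:
  assumes li: "lin_indep m (\<lambda>i. d ^ i)" and C: "centralizer d \<subseteq> span ((\<lambda>i. d ^ i) ` {..<m})"
  obtains k y where "lin_indep k (\<lambda>j. d * y j - y j * d)"
    "\<And>g. lin_indep m (\<lambda>i. g ^ i) \<Longrightarrow> lin_indep k (\<lambda>j. g * y j - y j * g) \<Longrightarrow>
       centralizer g \<subseteq> span ((\<lambda>i. g ^ i) ` {..<m})"
proof -
  obtain N w where w: "m \<le> N" "lin_indep N w" "\<And>i. i < m \<Longrightarrow> w i = d ^ i" "span (w ` {..<N}) = UNIV"
    using lin_indep_extend[OF li] by blast
  define k where "k = N - m"
  define y where "y j = w (m + j)" for j
  have N: "N = m + k" using w(1) by (simp add: k_def)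
  \<comment> \<open>A combination of the \<open>y j\<close> commuting with \<open>d\<close> lies in
    the span of the powers of \<open>d\<close>, which the \<open>y j\<close> complete to a basis; so
    it is trivial.\<close>
  have "lin_indep k (\<lambda>j. d * y j - y j * d)"
    unfolding lin_indep_iff
  proof (rule allI, rule impI)
    fix c assume "(\<Sum>j<k. scale (c j) (d * y j - y j * d)) = 0"
    then have "(\<Sum>j<k. scale (c j) (y j)) \<in> centralizer d"
      by (simp add: centralizer_def sum_distrib_left sum_distrib_right scale_mult_left scale_mult_right
        scale_right_diff_distrib sum_subtractf)
    then have "(\<Sum>j<k. scale (c j) (y j)) \<in> span ((\<lambda>i. d ^ i) ` {..<m})" using C by blast
    then obtain b where b: "(\<Sum>j<k. scale (c j) (y j)) = (\<Sum>i<m. scale (b i) (d ^ i))"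
      unfolding span_family_iff by blast
    let ?c = "\<lambda>i. if i < m then - b i else c (i - m)"
    have "(\<Sum>i<N. scale (?c i) (w i)) = 0"
      unfolding N sum_lessThan_add using b by (simp add: w(3) y_def sum_negf)
    then have "\<forall>i<N. ?c i = 0" using w(2) unfolding lin_indep_iff by (elim allE[of _ ?c]) simp
    then show "\<forall>j<k. c j = 0" unfolding N by (metis add_diff_cancel_left' nat_add_left_cancel_less not_add_less1)
  qed
  moreover have "centralizer g \<subseteq> span ((\<lambda>i. g ^ i) ` {..<m})"
    if g: "lin_indep m (\<lambda>i. g ^ i)" "lin_indep k (\<lambda>j. g * y j - y j * g)" for g
  proof
    fix z assume z: "z \<in> centralizer g"
    show "z \<in> span ((\<lambda>i. g ^ i) ` {..<m})"
    proof (rule ccontr)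
      assume non: "z \<notin> span ((\<lambda>i. g ^ i) ` {..<m})"
      \<comment> \<open>A further element of the centralizer would give \<open>m + 1 + k\<close>
        independent vectors in dimension \<open>N = m + k\<close>.\<close>
      let ?p = "(\<lambda>i. g ^ i)(m := z)"
      have "?p ` {..<m} = (\<lambda>i. g ^ i) ` {..<m}" by auto
      moreover have "lin_indep m ?p = lin_indep m (\<lambda>i. g ^ i)" by (rule lin_indep_cong) simp
      ultimately have "lin_indep (Suc m) ?p" using g(1) non by (simp add: lin_indep_Suc)
      moreover have "?p i \<in> centralizer g" for i using z by (simp add: power_mem_centralizer)
      ultimately have "lin_indep (Suc m + k) (\<lambda>i. if i < Suc m then ?p i else y (i - Suc m))"
        using g(2) by (rule lin_indep_append)
      then have "Suc m + k \<le> N" by (rule lin_indep_le_of_span[OF w(4)])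
      then show False using N by simp
    qed
  qed
  ultimately show ?thesis by (rule that)
qed

lemma power_scale: "scale t a ^ i = scale (t ^ i) (a ^ i)"
  by (induction i) (simp_all add: scale_mult_left scale_mult_right)

text \<open>With \<open>\<Sum>i\<le>M. c i * a^i = 0\<close> and \<open>y = - s a\<close>, weight
  \<open>(1 - y) * (1 + ... + y^(i-1)) = 1 - y^i\<close> by \<open>c i * (- s)^(M - i)\<close> and
  sum over \<open>i\<close>. The terms in \<open>y^i\<close> add up to \<open>(- s)^M\<close> times
  the relation, so only a scalar remains: \<open>q\<close>, the reversed polynomial at
  \<open>- s\<close>, with \<open>q(0) = c M = 1\<close>.\<close>

lemma ex_poly_inverse:
  obtains r q where "poly_fun r" "poly q 0 = 1" "r 0 = 1"
    "\<And>s. (1 + scale s a) * r s = scale (poly q s) 1"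
proof -
  obtain b where b: "\<And>N w. lin_indep N w \<Longrightarrow> N \<le> b" using lin_indep_bounded by blast
  define M where "M = (LEAST M. \<not> lin_indep (Suc M) (\<lambda>i. a ^ i))"
  have "\<not> lin_indep (Suc b) (\<lambda>i. a ^ i)" using b by fastforce
  then have M: "\<not> lin_indep (Suc M) (\<lambda>i. a ^ i)" unfolding M_def by (rule LeastI)
  have "lin_indep M (\<lambda>i. a ^ i)"
  proof (cases M)
    case (Suc M')
    then show ?thesis using not_less_Least[of M' "\<lambda>M. \<not> lin_indep (Suc M) (\<lambda>i. a ^ i)"] by (simp add: M_def)
  qed simp
  with M have "a ^ M \<in> span ((\<lambda>i. a ^ i) ` {..<M})" by (simp add: lin_indep_Suc)
  then obtain k where k: "a ^ M = (\<Sum>i<M. scale (k i) (a ^ i))" by (auto simp: span_family_iff)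
  define c where "c i = (if i < M then - k i else 1)" for i
  have rel: "(\<Sum>i\<le>M. scale (c i) (a ^ i)) = 0"
    by (simp add: c_def k sum_negf flip: lessThan_Suc_atMost)
  define q where "q = (\<Sum>i\<le>M. smult (c i) ([:0, -1:] ^ (M - i)))"
  define r where "r s = (\<Sum>i\<le>M. scale (c i) (scale (poly ([:0, -1:] ^ (M - i)) s) (\<Sum>j<i. scale (- s) a ^ j)))" for s
  have "poly_fun (\<lambda>s. scale (- s) a)"
    using poly_fun.scale[OF poly_fun.const[of "- a"]] by simp
  then have "poly_fun r"
    unfolding r_def[abs_def] by (intro poly_fun_sum poly_fun_scale_const poly_fun_scale_poly poly_fun_power)
  moreover have "poly q 0 = 1"
    by (simp add: q_def poly_sum c_def zero_power flip: lessThan_Suc_atMost)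
  moreover have id: "(1 + scale s a) * r s = scale (poly q s) 1" for s
  proof -
    have "(1 + scale s a) * r s
        = (\<Sum>i\<le>M. scale (c i * (- s) ^ (M - i)) ((1 - scale (- s) a) * (\<Sum>j<i. scale (- s) a ^ j)))"
      by (simp add: r_def sum_distrib_left scale_mult_right)
    also have "\<dots> = (\<Sum>i\<le>M. scale (c i * (- s) ^ (M - i)) 1 - scale ((- s) ^ M) (scale (c i) (a ^ i)))"
      unfolding mult_geometric_sum
    proof (intro sum.cong refl)
      fix i assume "i \<in> {..M}"
      then have "(- s) ^ (M - i) * (- s) ^ i = (- s) ^ M" by (simp flip: power_add)
      then have "c i * (- s) ^ (M - i) * (- s) ^ i = (- s) ^ M * c i"
        by (simp add: mult.assoc mult.commute[of "c i"])
      then show "scale (c i * (- s) ^ (M - i)) (1 - scale (- s) a ^ i)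
        = scale (c i * (- s) ^ (M - i)) 1 - scale ((- s) ^ M) (scale (c i) (a ^ i))"
        unfolding power_scale scale_right_diff_distrib scale_scale by simp
    qed
    also have "\<dots> = scale (poly q s) 1 - scale ((- s) ^ M) (\<Sum>i\<le>M. scale (c i) (a ^ i))"
      by (simp add: sum_subtractf q_def poly_sum scale_sum_left scale_sum_right)
    also have "\<dots> = scale (poly q s) 1" by (simp add: rel)
    finally show ?thesis .
  qed
  moreover have "r 0 = 1" using id[of 0] \<open>poly q 0 = 1\<close> by simp
  ultimately show ?thesis using that by blast
qed

section \<open>Subfields generated by one element\<close>

lemma adjoin_mem: "c \<in> adjoin scale c" "scale a 1 \<in> adjoin scale c"
  unfolding adjoin_def using hull_subset[of "insert c (scalars scale)" is_subfield]
  by (auto simp: scalars_def)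

lemma scale_mem_adjoin: "x \<in> adjoin scale c \<Longrightarrow> scale a x \<in> adjoin scale c"
  using subfield_closed(4)[OF is_subfield_adjoin adjoin_mem(2)] by (metis scale_one_mult)

lemma span_powers_subset_adjoin:
  assumes "g \<in> adjoin scale c"
  shows "span ((\<lambda>i. g ^ i) ` A) \<subseteq> adjoin scale c"
  using assms
  by (intro span_minimal)
     (auto simp: subspace_def subfield_closed[OF is_subfield_adjoin] scale_mem_adjoin)

text \<open>A subfield containing \<open>c\<close> is commutative and so lies in the centralizer of
  \<open>c\<close>.\<close>

lemma is_maximal_subfield_adjoin:
  assumes "centralizer c \<subseteq> adjoin scale c"
  shows "is_maximal_subfield (adjoin scale c)"
  unfolding is_maximal_subfield_def
proof (intro conjI allI impI is_subfield_adjoin)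
  fix K assume K: "is_subfield K \<and> adjoin scale c \<subseteq> K"
  then have "K \<subseteq> centralizer c"
    using adjoin_mem(1)[of c] unfolding is_subfield_def centralizer_def by blast
  then show "K = adjoin scale c" using assms K by blast
qed

text \<open>Maximal degree and noncommutation of \<open>a\<close> with \<open>d\<close> are both
  generic along a line of left entries: the first holds at one point, the second at another, so some
  point has both.\<close>

lemma ex_additive_commutator:
  assumes inf: "infinite (UNIV :: 'f set)" and non: "ring_center \<noteq> (UNIV :: 'd set)"
  obtains a b m where "lin_indep m (\<lambda>i. (a * b - b * a) ^ i)"
    "centralizer (a * b - b * a) \<subseteq> span ((\<lambda>i. (a * b - b * a) ^ i) ` {..<m})"
proof -
  let ?P = "\<lambda>m. \<exists>a b. lin_indep m (\<lambda>i. (a * b - b * a) ^ i)"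
  obtain N where N: "\<And>m v. lin_indep m v \<Longrightarrow> m \<le> N" using lin_indep_bounded by blast
  define m where "m = Greatest ?P"
  have bound: "\<And>k. ?P k \<Longrightarrow> k \<le> N" using N by auto
  have m: "?P m" unfolding m_def by (rule GreatestI_nat[of ?P 0 N]) (use bound in auto)
  have max: "k \<le> m" if "?P k" for k
    unfolding m_def by (rule Greatest_le_nat[of ?P k N]) (use that bound in auto)
  have "\<exists>a b. b \<notin> ring_center \<and> lin_indep m (\<lambda>i. (a * b - b * a) ^ i)"
  proof (cases "m \<le> 1")
    case True
    obtain b :: 'd where "b \<notin> ring_center" using non by blast
    \<comment> \<open>For \<open>m \<le> 1\<close> even the commutator 0 serves, as
      \<open>0 ^ 0 = 1\<close>.\<close>
    moreover have "lin_indep m (\<lambda>i. (b * b - b * b) ^ i)"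
      using True by (cases m) (auto simp: lin_indep_Suc)
    ultimately show ?thesis by blast
  next
    case False
    obtain a b where ab: "lin_indep m (\<lambda>i. (a * b - b * a) ^ i)" using m by blast
    have "b \<notin> ring_center"
    proof
      assume "b \<in> ring_center"
      then have "a * b - b * a = 0" by (simp add: ring_center_def)
      moreover have "lin_indep (Suc (Suc 0)) (\<lambda>i. (a * b - b * a) ^ i)"
        using lin_indep_mono[OF ab] False by simp
      ultimately show False by (simp add: lin_indep_Suc span_zero)
    qed
    then show ?thesis using ab by blast
  qed
  then obtain a b where b: "b \<notin> ring_center" and ab: "lin_indep m (\<lambda>i. (a * b - b * a) ^ i)" by blast
  obtain u where u: "u * (u * b - b * u) - (u * b - b * u) * u \<noteq> 0"
    using ex_double_commutator[OF b] by blast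
  \<comment> \<open>The line runs from \<open>a\<close> at \<open>s = 0\<close> to \<open>u\<close>
    at \<open>s = 1\<close>; there \<open>a' s * d s - d s * a' s\<close> is the nonzero double
    commutator.\<close>
  define a' where "a' s = a + scale s (u - a)" for s
  define d where "d s = a' s * b - b * a' s" for s
  have a': "poly_fun a'" unfolding a'_def[abs_def] by (intro poly_fun.intros)
  then have d: "poly_fun d" unfolding d_def[abs_def] by (intro poly_fun_diff poly_fun_mult poly_fun.const)
  have "eventually (\<lambda>s. lin_indep m (\<lambda>i. d s ^ i)) cofinite"
  proof (rule lin_indep_cofinite[of _ _ 0])
    show "lin_indep m (\<lambda>i. d 0 ^ i)" using ab by (simp add: d_def a'_def)
  qed (intro poly_fun_power d)
  \<comment> \<open>Independence of a one-element family expresses that the vector is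
    nonzero.\<close>
  moreover have "eventually (\<lambda>s. lin_indep (Suc 0) (\<lambda>i. a' s * d s - d s * a' s)) cofinite"
  proof (rule lin_indep_cofinite[of _ _ 1])
    show "lin_indep (Suc 0) (\<lambda>i. a' 1 * d 1 - d 1 * a' 1)" using u by (simp add: lin_indep_Suc d_def a'_def)
  qed (intro poly_fun_diff poly_fun_mult d a')
  ultimately have "eventually (\<lambda>s. lin_indep m (\<lambda>i. d s ^ i) \<and> lin_indep (Suc 0) (\<lambda>i. a' s * d s - d s * a' s)) cofinite"
    by (rule eventually_conj)
  then obtain s where s: "lin_indep m (\<lambda>i. d s ^ i)" "lin_indep (Suc 0) (\<lambda>i. a' s * d s - d s * a' s)"
    using ex_of_eventually_cofinite[OF inf] by blast
  have "centralizer (d s) \<subseteq> span ((\<lambda>i. d s ^ i) ` {..<m})"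
  proof (rule centralizer_subset_of_max_degree[OF inf d_def _ s(1)])
    show "a' s * d s \<noteq> d s * a' s" using s(2) by (auto simp: lin_indep_Suc)
    show "\<not> lin_indep (Suc m) (\<lambda>i. (a' s * y - y * a' s) ^ i)" for y
    proof
      assume "lin_indep (Suc m) (\<lambda>i. (a' s * y - y * a' s) ^ i)"
      then have "Suc m \<le> m" by (intro max exI)
      then show False by simp
    qed
  qed
  then show ?thesis using that[of m "a' s" b] s(1) by (simp add: d_def)
qed

theorem ex_commutator_maximal_subfield:
  "\<exists>x y. x \<noteq> 0 \<and> y \<noteq> 0 \<and> is_maximal_subfield (adjoin scale (x * y * inverse x * inverse y))"
proof (cases "ring_center = (UNIV :: 'd set)")
  case True
  have "x \<in> adjoin scale c" for x c :: 'd
  proof -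
    have "x \<in> scalars scale" using True by (simp flip: center_eq_scalars)
    then show ?thesis using adjoin_mem(2) by (auto simp: scalars_def)
  qed
  then have "adjoin scale c = UNIV" for c by blast
  then have "is_maximal_subfield (adjoin scale c)" for c
    by (intro is_maximal_subfield_adjoin) simp
  then show ?thesis by (intro exI[of _ 1]) simp
next
  case False
  then have inf: "infinite (UNIV :: 'f set)" using wedderburn_little by blast
  obtain a b m where li: "lin_indep m (\<lambda>i. (a * b - b * a) ^ i)"
    and C: "centralizer (a * b - b * a) \<subseteq> span ((\<lambda>i. (a * b - b * a) ^ i) ` {..<m})"
    by (rule ex_additive_commutator[OF inf False])
  define d where "d = a * b - b * a"
  obtain k w where w: "lin_indep k (\<lambda>j. d * w j - w j * d)"
    and rank: "\<And>g. lin_indep m (\<lambda>i. g ^ i) \<Longrightarrow> lin_indep k (\<lambda>j. g * w j - w j * g) \<Longrightarrow>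
       centralizer g \<subseteq> span ((\<lambda>i. g ^ i) ` {..<m})"
    by (rule centralizer_rank_witness[OF li C, folded d_def]) blast
  obtain ra qa where a: "poly_fun ra" "poly qa 0 = 1" "ra 0 = 1" "\<And>s. (1 + scale s a) * ra s = scale (poly qa s) 1"
    by (rule ex_poly_inverse) blast
  obtain rb qb where b: "poly_fun rb" "poly qb 0 = 1" "rb 0 = 1" "\<And>s. (1 + scale s b) * rb s = scale (poly qb s) 1"
    by (rule ex_poly_inverse) blast
  \<comment> \<open>\<open>ra s\<close> and \<open>rb s\<close> are scalar multiples of the inverses
    of \<open>1 + scale s a\<close> and \<open>1 + scale s b\<close>, chosen polynomial in
    \<open>s\<close>; the scalars reappear in \<open>\<mu>\<close>.\<close>
  define g where "g s = d * ra s * rb s" for s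
  have g: "poly_fun g" unfolding g_def[abs_def] by (intro poly_fun_mult poly_fun.const a b)
  have g0: "g 0 = d" by (simp add: g_def a b)
  have "qa \<noteq> 0" "qb \<noteq> 0" using a(2) b(2) by auto
  then have "eventually (\<lambda>s. poly qa s \<noteq> 0) cofinite" "eventually (\<lambda>s. poly qb s \<noteq> 0) cofinite"
    using poly_roots_finite by (auto simp: eventually_cofinite)
  moreover have "eventually (\<lambda>s. s \<noteq> (0 :: 'f)) cofinite" by (simp add: eventually_cofinite)
  moreover have "eventually (\<lambda>s. lin_indep m (\<lambda>i. g s ^ i)) cofinite"
    by (rule lin_indep_cofinite[of _ _ 0]) (use li in \<open>auto intro: poly_fun_power g simp: g0 d_def\<close>)
  moreover have "eventually (\<lambda>s. lin_indep k (\<lambda>j. g s * w j - w j * g s)) cofinite"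
    by (rule lin_indep_cofinite[of _ _ 0])
       (use w in \<open>auto intro!: poly_fun_diff poly_fun_mult poly_fun.const g simp: g0\<close>)
  ultimately have "eventually (\<lambda>s. poly qa s \<noteq> 0 \<and> poly qb s \<noteq> 0 \<and> s \<noteq> 0 \<and> lin_indep m (\<lambda>i. g s ^ i)
      \<and> lin_indep k (\<lambda>j. g s * w j - w j * g s)) cofinite"
    by (intro eventually_conj)
  then obtain s where s: "poly qa s \<noteq> 0" "poly qb s \<noteq> 0" "s \<noteq> 0" "lin_indep m (\<lambda>i. g s ^ i)"
    "lin_indep k (\<lambda>j. g s * w j - w j * g s)"
    using ex_of_eventually_cofinite[OF inf] by blast
  define x y where "x = 1 + scale s a" and "y = 1 + scale s b"
  define \<mu> where "\<mu> = s\<^sup>2 * inverse (poly qa s) * inverse (poly qb s)"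
  have "x * scale (inverse (poly qa s)) (ra s) = 1" "y * scale (inverse (poly qb s)) (rb s) = 1"
    using s by (simp_all add: x_def y_def scale_mult_right a b)
  then have inv: "x \<noteq> 0" "y \<noteq> 0" "inverse x = scale (inverse (poly qa s)) (ra s)"
    "inverse y = scale (inverse (poly qb s)) (rb s)"
    using inverse_unique by auto
  let ?c = "x * y * inverse x * inverse y"
  \<comment> \<open>The constant and linear terms of \<open>x * y\<close> and \<open>y * x\<close>
    agree, so only \<open>s\<close> squared times \<open>a * b - b * a\<close> survives.\<close>
  have "x * y = scale (s\<^sup>2) d + y * x"
    by (simp add: x_def y_def d_def algebra_simps scale_mult_left scale_mult_right power2_eq_square
        scale_right_diff_distrib)
  then have "?c = (scale (s\<^sup>2) d + y * x) * inverse x * inverse y" by (rule arg_cong)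
  also have "\<dots> = scale (s\<^sup>2) d * inverse x * inverse y + 1"
    using inv(1,2) by (simp add: distrib_right mult.assoc inverse_mult_cancel)
  also have "scale (s\<^sup>2) d * inverse x * inverse y = scale \<mu> (g s)"
    by (simp add: inv(3,4) g_def \<mu>_def scale_mult_left scale_mult_right mult_ac)
  finally have c: "?c = scale \<mu> (g s) + 1" .
  have \<mu>: "\<mu> \<noteq> 0" using s by (simp add: \<mu>_def)
  have gc: "g s = scale (inverse \<mu>) (?c - 1)" using \<mu> by (simp add: c)
  \<comment> \<open>\<open>g s\<close> is an affine function of the commutator over
    \<open>F\<close>: what commutes with the latter commutes with \<open>g s\<close>, and
    \<open>g s\<close> lies in the field the commutator generates.\<close>
  have "centralizer ?c \<subseteq> centralizer (g s)"
    unfolding gc centralizer_def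
    by (clarify, simp add: scale_mult_left scale_mult_right left_diff_distrib right_diff_distrib)
  also have "\<dots> \<subseteq> span ((\<lambda>i. g s ^ i) ` {..<m})" by (rule rank[OF s(4,5)])
  also have "\<dots> \<subseteq> adjoin scale ?c"
  proof (rule span_powers_subset_adjoin)
    show "g s \<in> adjoin scale ?c"
      by (subst gc) (intro scale_mem_adjoin subfield_closed[OF is_subfield_adjoin] adjoin_mem)
  qed
  finally have "is_maximal_subfield (adjoin scale ?c)" by (rule is_maximal_subfield_adjoin)
  then show ?thesis using inv(1,2) by (intro exI[of _ x] exI[of _ y]) simp
qed

end

theorem theorem2p5:
  fixes scale :: "'f::field \<Rightarrow> 'd::division_ring \<Rightarrow> 'd"
  assumes "central_division_algebra scale"
  shows "\<exists>x y :: 'd. x \<noteq> 0 \<and> y \<noteq> 0 \<and>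
           is_maximal_subfield (adjoin scale (x * y * inverse x * inverse y))"
  using assms by (rule central_division_algebra.ex_commutator_maximal_subfield)

end
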